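(* Let $p \in [1, \infty) \setminus \{ 2 \}$. Let $(X,\mathcal{B},\mu)$ be a $\sigma$-finite measure space, and let $e \in L(L^p(X,\mu))$ be an idempotent. Then the following are equivalent: (1) $e$ is a hermitian idempotent. (2) $e$ is a spatial partial isometry. (3) There is a measurable subset $E \subset X$ such that $e$ is multiplication by the characteristic function $\chi_E$.
   Context: Scalars are complex. $L(E)$ is the Banach algebra of bounded operators on a Banach space $E$. Hermitian idempotent: in a unital Banach algebra with $\|1\|=1$, an idempotent $e$ is hermitian if $\|\exp(i\lambda e)\|=1$ for all $\lambda\in\mathbb{R}$ (equivalently, its numerical range $\{\omega(e):\|\omega\|=\omega(1)=1\}$ is contained in $\mathbb{R}$). In the zero algebra, the element $0$ is regarded as hermitian. Spatial partial isometry: Let $\mathcal{N}(\mu)$ denote the null sets. A spatial system on $(X,\mathcal{B},\mu)$ is a quadruple $(E,F,S,g)$ with $E,F\in\mathcal{B}$, $S$ an isomorphism of $\sigma$-complete Boolean algebras from the measurable subsets of $E$ modulo null sets to the measurable subsets of $F$ modulo null sets, and $g\colon F\to\mathbb{C}$ measurable with $|g|=1$ almost everywhere. $S$ induces a map $S_*$ from classes (mod a.e. equality) of measurable functions on $E$ to those on $F$, determined by $\{S_*(\xi)\in U\}=S(\{\xi\in U\})$ for Borel $U\subset\mathbb{C}$, and a measure $S_*(\mu|_E)=\mu|_E\circ S^{-1}$ on $F$. An operator $s\in L(L^p(X,\mu))$ is a spatial partial isometry if there is a spatial system $(E,F,S,g)$ such that for all $\xi\in L^p(X,\mu)$, $(s\xi)(y)=g(y)\Big(\frac{dS_*(\mu|_E)}{d\mu|_F}(y)\Big)^{1/p}S_*(\xi|_E)(y)$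 for $y\in F$ and $(s\xi)(y)=0$ for $y\notin F$. *)

theory Defs
  imports "HOL-Analysis.Analysis"
begin

text \<open>Elements of \<open>L\<^sup>p(X,\<mu>)\<close> are represented by \<open>p\<close>-integrable functions, two of which represent the
  same element iff they agree almost everywhere. Accordingly, a bounded operator on \<open>L\<^sup>p\<close> is
  represented by a map on functions that respects almost everywhere equality, and two such maps
  represent the same operator iff \<open>Lp_op_eq\<close> holds.\<close>

definition Lp :: "real \<Rightarrow> 'a measure \<Rightarrow> ('a \<Rightarrow> complex) set" where
  "Lp p M = {\<xi> \<in> borel_measurable M. integrable M (\<lambda>x. cmod (\<xi> x) powr p)}"

definition Lp_norm :: "real \<Rightarrow> 'a measure \<Rightarrow> ('a \<Rightarrow> complex) \<Rightarrow> real" where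
  "Lp_norm p M \<xi> = (LINT x|M. cmod (\<xi> x) powr p) powr (1 / p)"

type_synonym 'a fun_op = "('a \<Rightarrow> complex) \<Rightarrow> ('a \<Rightarrow> complex)"

definition Lp_operator :: "real \<Rightarrow> 'a measure \<Rightarrow> 'a fun_op \<Rightarrow> bool" where
  "Lp_operator p M T \<longleftrightarrow>
     (\<forall>\<xi>\<in>Lp p M. T \<xi> \<in> Lp p M) \<and>
     (\<forall>\<xi>\<in>Lp p M. \<forall>\<eta>\<in>Lp p M. (AE x in M. \<xi> x = \<eta> x) \<longrightarrow> (AE x in M. T \<xi> x = T \<eta> x)) \<and>
     (\<forall>\<xi>\<in>Lp p M. \<forall>\<eta>\<in>Lp p M. AE x in M. T (\<lambda>x. \<xi> x + \<eta> x) x = T \<xi> x + T \<eta> x) \<and>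
     (\<forall>c. \<forall>\<xi>\<in>Lp p M. AE x in M. T (\<lambda>x. c * \<xi> x) x = c * T \<xi> x) \<and>
     (\<exists>C. \<forall>\<xi>\<in>Lp p M. Lp_norm p M (T \<xi>) \<le> C * Lp_norm p M \<xi>)"

definition Lp_op_eq :: "real \<Rightarrow> 'a measure \<Rightarrow> 'a fun_op \<Rightarrow> 'a fun_op \<Rightarrow> bool" where
  "Lp_op_eq p M S T \<longleftrightarrow> (\<forall>\<xi>\<in>Lp p M. AE x in M. S \<xi> x = T \<xi> x)"

definition Lp_opnorm :: "real \<Rightarrow> 'a measure \<Rightarrow> 'a fun_op \<Rightarrow> real" where
  "Lp_opnorm p M T = (SUP \<xi>\<in>{\<xi> \<in> Lp p M. Lp_norm p M \<xi> \<le> 1}. Lp_norm p M (T \<xi>))"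

definition Lp_idempotent :: "real \<Rightarrow> 'a measure \<Rightarrow> 'a fun_op \<Rightarrow> bool" where
  "Lp_idempotent p M e \<longleftrightarrow> Lp_op_eq p M (e \<circ> e) e"

text \<open>The exponential in the Banach algebra \<open>L(L\<^sup>p(X,\<mu>))\<close> is the limit, in operator norm, of the
  partial sums of the exponential series; it is unique up to \<open>Lp_op_eq\<close>, and its existence
  is the completeness of the algebra.\<close>

definition Lp_has_exp :: "real \<Rightarrow> 'a measure \<Rightarrow> 'a fun_op \<Rightarrow> 'a fun_op \<Rightarrow> bool" where
  "Lp_has_exp p M T B \<longleftrightarrow> Lp_operator p M B \<and>
     (\<lambda>n. Lp_opnorm p M (\<lambda>\<xi> x. (\<Sum>k<n. (T ^^ k) \<xi> x / fact k) - B \<xi> x)) \<longlonglongrightarrow> 0"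

definition Lp_exp :: "real \<Rightarrow> 'a measure \<Rightarrow> 'a fun_op \<Rightarrow> 'a fun_op" where
  "Lp_exp p M T = (SOME B. Lp_has_exp p M T B)"

text \<open>The first disjunct says that \<open>1 = 0\<close> in \<open>L(L\<^sup>p(X,\<mu>))\<close>, that is, that this is the zero
  algebra. Its only element \<open>0\<close> counts as hermitian although all norms vanish.\<close>

definition hermitian_idempotent :: "real \<Rightarrow> 'a measure \<Rightarrow> 'a fun_op \<Rightarrow> bool" where
  "hermitian_idempotent p M e \<longleftrightarrow> Lp_operator p M e \<and> Lp_idempotent p M e \<and>
     (Lp_op_eq p M (\<lambda>\<xi>. \<xi>) (\<lambda>\<xi> x. 0) \<or>
      (\<forall>t::real. Lp_opnorm p M (Lp_exp p M (\<lambda>\<xi> x. \<i> * of_real t * e \<xi> x)) = 1))"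

definition null_eq :: "'a measure \<Rightarrow> 'a set \<Rightarrow> 'a set \<Rightarrow> bool" where
  "null_eq M A B \<longleftrightarrow> (A - B) \<union> (B - A) \<in> null_sets M"

definition subsets_in :: "'a measure \<Rightarrow> 'a set \<Rightarrow> 'a set set" where
  "subsets_in M E = {A \<in> sets M. A \<subseteq> E}"

text \<open>A map between the algebras of measurable sets modulo null sets is likewise represented by a
  map on sets: the clauses say that it is well defined and injective on classes, surjective on
  classes, and that it preserves complements and countable unions (hence also \<open>\<emptyset>\<close>, the top
  element, and finite and countable unions and intersections).\<close>

definition measure_algebra_iso ::
    "'a measure \<Rightarrow> 'a set \<Rightarrow> 'a set \<Rightarrow> ('a set \<Rightarrow> 'a set) \<Rightarrow> bool" where
  "measure_algebra_iso M E F S \<longleftrightarrow>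
     (\<forall>A\<in>subsets_in M E. S A \<in> subsets_in M F) \<and>
     (\<forall>A\<in>subsets_in M E. \<forall>B\<in>subsets_in M E. null_eq M (S A) (S B) \<longleftrightarrow> null_eq M A B) \<and>
     (\<forall>B\<in>subsets_in M F. \<exists>A\<in>subsets_in M E. null_eq M (S A) B) \<and>
     (\<forall>A\<in>subsets_in M E. null_eq M (S (E - A)) (F - S A)) \<and>
     (\<forall>A::nat \<Rightarrow> 'a set. range A \<subseteq> subsets_in M E \<longrightarrow>
        null_eq M (S (\<Union>n. A n)) (\<Union>n. S (A n)))"

definition spatial_system ::
    "'a measure \<Rightarrow> 'a set \<Rightarrow> 'a set \<Rightarrow> ('a set \<Rightarrow> 'a set) \<Rightarrow> ('a \<Rightarrow> complex) \<Rightarrow> bool" where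
  "spatial_system M E F S g \<longleftrightarrow> E \<in> sets M \<and> F \<in> sets M \<and> measure_algebra_iso M E F S \<and>
     g \<in> borel_measurable (restrict_space M F) \<and> (AE y in restrict_space M F. cmod (g y) = 1)"

text \<open>\<open>S\<^sub>*(\<xi>)\<close>, for a function \<open>\<xi>\<close> of which only the values on \<open>E\<close> matter. The defining
  property determines it up to almost everywhere equality on \<open>F\<close>.\<close>

definition push_fun ::
    "'a measure \<Rightarrow> 'a set \<Rightarrow> 'a set \<Rightarrow> ('a set \<Rightarrow> 'a set) \<Rightarrow> ('a \<Rightarrow> complex) \<Rightarrow> ('a \<Rightarrow> complex)" where
  "push_fun M E F S \<xi> = (SOME \<eta>. \<eta> \<in> borel_measurable (restrict_space M F) \<and>
     (\<forall>U\<in>sets borel. null_eq M {y \<in> F. \<eta> y \<in> U} (S {x \<in> E. \<xi> x \<in> U})))"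

text \<open>\<open>\<mu>|\<^sub>E \<circ> S\<^sup>-\<^sup>1\<close> as a measure on \<open>F\<close>; the value does not depend on the representative of
  \<open>S\<^sup>-\<^sup>1(B)\<close>.\<close>

definition push_measure ::
    "'a measure \<Rightarrow> 'a set \<Rightarrow> 'a set \<Rightarrow> ('a set \<Rightarrow> 'a set) \<Rightarrow> 'a measure" where
  "push_measure M E F S = measure_of F (subsets_in M F)
     (\<lambda>B. emeasure M (SOME A. A \<in> subsets_in M E \<and> null_eq M (S A) B))"

definition spatial_partial_isometry :: "real \<Rightarrow> 'a measure \<Rightarrow> 'a fun_op \<Rightarrow> bool" where
  "spatial_partial_isometry p M s \<longleftrightarrow> Lp_operator p M s \<and>
     (\<exists>E F S g. spatial_system M E F S g \<and>
        (\<forall>\<xi>\<in>Lp p M. AE y in M. s \<xi> y =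
           (if y \<in> F
            then g y * of_real (enn2real (RN_deriv (restrict_space M F) (push_measure M E F S) y)
                                  powr (1 / p)) * push_fun M E F S \<xi> y
            else 0)))"

definition mult_op :: "'a set \<Rightarrow> 'a fun_op" where
  "mult_op E \<xi> = (\<lambda>x. indicator E x * \<xi> x)"

end

theory Submission
  imports Defs
begin

text \<open>The three conditions meet in the notion of a local operator: one for which \<open>T \<xi>\<close> vanishes
  almost everywhere on the zero set of \<open>\<xi>\<close>. A bounded local idempotent \<open>e\<close> is multiplication by an
  indicator function (\<open>Lp_local_idempotent_is_mult_op\<close>), because functions in its range and functions
  in its kernel have disjoint supports: near a point where \<open>u\<close> in the range and \<open>v\<close> in the kernel
  are both nonzero, some \<open>u - c v\<close> is tiny compared with \<open>u\<close>, and \<open>e\<close> maps it to \<open>u\<close>.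

  If \<open>e\<close> is hermitian, the operators \<open>exp (\<i> t e) = 1 + (exp (\<i> t) - 1) e\<close> are isometries. For
  \<open>p \<noteq> 2\<close> an isometry of \<open>L\<^sup>p\<close> preserves disjointness of supports, by the equality case of
  Clarkson's inequality (\<open>isometry_preserves_disjointness\<close>). Comparing two values of \<open>t\<close> shows that
  \<open>e\<close> is local (\<open>hermitian_idempotent_local\<close>).

  If \<open>e\<close> is a spatial partial isometry, the support of \<open>e \<xi>\<close> is obtained from the support of \<open>\<xi>\<close>
  by a map \<open>T\<close> of measurable sets modulo null sets, which is onto the subsets of some set \<open>H\<close>.
  Idempotence of \<open>e\<close> makes \<open>T\<close> idempotent, hence the identity on subsets of \<open>H\<close>, and again
  \<open>e\<close> is local (\<open>spatial_idempotent_local\<close>). This argument needs \<open>S\<^sub>*(\<xi>)\<close> to exist, which is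
  shown in \<open>push_exists\<close>.

  Conversely, for a multiplication by an indicator function the exponential series is explicit and
  multiplies by unimodular functions, and the identity map of the measurable subsets of \<open>E\<close> is a
  spatial system for it.\<close>

section \<open>A parallelogram inequality for complex numbers\<close>

lemma powr_midpoint_convex:
  fixes x y q :: real
  assumes "1 \<le> q" "0 \<le> x" "0 \<le> y"
  shows "((x + y) / 2) powr q \<le> (x powr q + y powr q) / 2"
proof -
  have half: "(z / 2) powr q \<le> z powr q / 2" if "0 \<le> z" for z :: real
  proof -
    have "(1 / 2 :: real) powr q \<le> (1 / 2) powr 1"
      using assms(1) by (intro powr_mono') auto
    hence "z powr q * (1 / 2) powr q \<le> z powr q * (1 / 2)"
      by (intro mult_left_mono) auto
    thus ?thesis using that by (simp add: powr_divide)
  qed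
  consider "x = 0" | "y = 0" | "x > 0" "y > 0" using assms by linarith
  thus ?thesis
  proof cases
    case 3
    have "((1 - 1/2) *\<^sub>R x + (1/2) *\<^sub>R y) powr q \<le> (1 - 1/2) * x powr q + (1/2) * y powr q"
      using 3 by (intro convex_onD[OF powr_convex[OF assms(1)]]) auto
    thus ?thesis by (simp add: field_simps)
  qed (use half assms in auto)
qed

lemma powr_midpoint_concave:
  fixes x y q :: real
  assumes "0 < q" "q \<le> 1" "0 \<le> x" "0 \<le> y"
  shows "(x powr q + y powr q) / 2 \<le> ((x + y) / 2) powr q"
proof -
  have "((x powr q + y powr q) / 2) powr (1 / q) \<le> (x + y) / 2"
    using powr_midpoint_convex[of "1 / q" "x powr q" "y powr q"] assms by (simp add: powr_powr)
  hence "(((x powr q + y powr q) / 2) powr (1 / q)) powr q \<le> ((x + y) / 2) powr q"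
    using assms by (intro powr_mono2) auto
  thus ?thesis using assms by (simp add: powr_powr)
qed

lemma powr_strict_subadditive:
  fixes s t q :: real
  assumes "0 < q" "q < 1" "0 < s" "0 < t"
  shows "(s + t) powr q < s powr q + t powr q"
proof -
  have split: "z powr q = z * z powr (q - 1)" if "z > 0" for z :: real
    using that by (simp add: powr_diff)
  have "(s + t) powr q = s * (s + t) powr (q - 1) + t * (s + t) powr (q - 1)"
    using split[of "s + t"] assms by (simp add: distrib_right)
  also have "\<dots> < s * s powr (q - 1) + t * t powr (q - 1)"
    using assms by (intro add_strict_mono mult_strict_left_mono powr_less_mono2_neg) auto
  finally show ?thesis using split assms by simp
qed

lemma powr_strict_superadditive:
  fixes s t q :: real
  assumes "1 < q" "0 < s" "0 < t"
  shows "s powr q + t powr q < (s + t) powr q"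
proof -
  have split: "z powr q = z * z powr (q - 1)" if "z > 0" for z :: real
    using that by (simp add: powr_diff)
  have "s * s powr (q - 1) + t * t powr (q - 1) < s * (s + t) powr (q - 1) + t * (s + t) powr (q - 1)"
    using assms by (intro add_strict_mono mult_strict_left_mono powr_less_mono2) auto
  also have "\<dots> = (s + t) powr q"
    using split[of "s + t"] assms by (simp add: distrib_right)
  finally show ?thesis using split assms by simp
qed

text \<open>Clarkson's inequality between the p-th powers reverses its direction at \<open>p = 2\<close>; the sign
  makes the defect nonnegative on both sides.\<close>

definition parallelogram_defect :: "real \<Rightarrow> complex \<Rightarrow> complex \<Rightarrow> real" where
  "parallelogram_defect p a b =
     (if p < 2 then 1 else -1) *
     (2 * (cmod a powr p + cmod b powr p) - cmod (a + b) powr p - cmod (a - b) powr p)"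

lemma cmod_powr_eq_square_powr: "cmod z powr p = ((cmod z)\<^sup>2) powr (p / 2)"
  by (cases "z = 0") (simp_all add: powr_powr flip: powr_numeral)

lemma parallelogram_law_cmod: "((cmod (a + b))\<^sup>2 + (cmod (a - b))\<^sup>2) / 2 = (cmod a)\<^sup>2 + (cmod b)\<^sup>2"
  by (simp only: cmod_power2) (simp add: power2_eq_square algebra_simps)

text \<open>The parallelogram law fixes the mean of the squares of the two diagonals. For \<open>p < 2\<close> the
  function \<open>t powr (p / 2)\<close> is concave and, on positive numbers, strictly subadditive; for \<open>p > 2\<close>
  it is convex and strictly superadditive. Both properties push in the same direction.\<close>

lemma parallelogram_defect_pos:
  assumes "1 \<le> p" "p \<noteq> 2" "a \<noteq> 0" "b \<noteq> 0"
  shows "0 < parallelogram_defect p a b"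
proof -
  let ?s = "(cmod a)\<^sup>2" and ?t = "(cmod b)\<^sup>2" and ?q = "p / 2"
  let ?x = "(cmod (a + b))\<^sup>2" and ?y = "(cmod (a - b))\<^sup>2"
  have pos: "0 < ?s" "0 < ?t" using assms by auto
  show ?thesis
  proof (cases "p < 2")
    case True
    have "(?x powr ?q + ?y powr ?q) / 2 \<le> (?s + ?t) powr ?q"
      using powr_midpoint_concave[of ?q ?x ?y] True assms unfolding parallelogram_law_cmod by simp
    also have "\<dots> < ?s powr ?q + ?t powr ?q"
      using True assms pos by (intro powr_strict_subadditive) auto
    finally show ?thesis
      unfolding parallelogram_defect_def cmod_powr_eq_square_powr[of _ p] using True by simp
  next
    case False
    have "?s powr ?q + ?t powr ?q < (?s + ?t) powr ?q"
      using False assms pos by (intro powr_strict_superadditive) auto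
    also have "\<dots> \<le> (?x powr ?q + ?y powr ?q) / 2"
      using powr_midpoint_convex[of ?q ?x ?y] False assms unfolding parallelogram_law_cmod by simp
    finally show ?thesis
      unfolding parallelogram_defect_def cmod_powr_eq_square_powr[of _ p] using False by simp
  qed
qed

lemma parallelogram_defect_0:
  assumes "0 < p" "a = 0 \<or> b = 0"
  shows "parallelogram_defect p a b = 0"
  using assms by (auto simp: parallelogram_defect_def norm_minus_commute)

lemma parallelogram_defect_nonneg:
  "1 \<le> p \<Longrightarrow> p \<noteq> 2 \<Longrightarrow> 0 \<le> parallelogram_defect p a b"
  using parallelogram_defect_pos[of p a b] parallelogram_defect_0[of p a b] by fastforce

section \<open>The spaces of p-integrable functions\<close>

lemma Lp_borel: "f \<in> Lp p M \<Longrightarrow> f \<in> borel_measurable M"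
  by (simp add: Lp_def)

lemma Lp_integrable: "f \<in> Lp p M \<Longrightarrow> integrable M (\<lambda>x. cmod (f x) powr p)"
  by (simp add: Lp_def)

lemma Lp_dominated:
  assumes "0 \<le> p" "g \<in> Lp p M" "f \<in> borel_measurable M" "AE x in M. cmod (f x) \<le> cmod (g x)"
  shows "f \<in> Lp p M"
proof -
  have "integrable M (\<lambda>x. cmod (f x) powr p)"
  proof (rule Bochner_Integration.integrable_bound[OF Lp_integrable[OF assms(2)]])
    show "AE x in M. norm (cmod (f x) powr p) \<le> norm (cmod (g x) powr p)"
      using assms(4) by eventually_elim (use assms(1) in \<open>auto intro!: powr_mono2\<close>)
  qed (use assms(3) in measurable)
  thus ?thesis using assms(3) by (simp add: Lp_def)
qed

lemma Lp_zero: "(\<lambda>x. 0) \<in> Lp p M"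
  by (simp add: Lp_def)

lemma Lp_scale:
  assumes "f \<in> Lp p M"
  shows "(\<lambda>x. c * f x) \<in> Lp p M"
  using assms by (auto simp: Lp_def norm_mult powr_mult)

lemma Lp_add:
  assumes "0 \<le> p" "f \<in> Lp p M" "g \<in> Lp p M"
  shows "(\<lambda>x. f x + g x) \<in> Lp p M"
proof -
  note [measurable] = assms(2,3)[THEN Lp_borel]
  have "integrable M (\<lambda>x. cmod (f x + g x) powr p)"
  proof (rule Bochner_Integration.integrable_bound)
    show "integrable M (\<lambda>x. 2 powr p * (cmod (f x) powr p + cmod (g x) powr p))"
      using assms by (intro integrable_mult_right Bochner_Integration.integrable_add Lp_integrable)
    show "AE x in M. norm (cmod (f x + g x) powr p)
        \<le> norm (2 powr p * (cmod (f x) powr p + cmod (g x) powr p))"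
    proof (rule AE_I2)
      fix x
      have "cmod (f x + g x) \<le> 2 * max (cmod (f x)) (cmod (g x))"
        using norm_triangle_ineq[of "f x" "g x"] by linarith
      hence "cmod (f x + g x) powr p \<le> (2 * max (cmod (f x)) (cmod (g x))) powr p"
        using assms(1) by (intro powr_mono2) auto
      also have "\<dots> = 2 powr p * max (cmod (f x)) (cmod (g x)) powr p"
        by (intro powr_mult)
      also have "\<dots> \<le> 2 powr p * (cmod (f x) powr p + cmod (g x) powr p)"
        by (intro mult_left_mono) (auto simp: max_def)
      finally show "norm (cmod (f x + g x) powr p)
        \<le> norm (2 powr p * (cmod (f x) powr p + cmod (g x) powr p))" by simp
    qed
  qed measurable
  thus ?thesis by (simp add: Lp_def)
qed

lemma Lp_diff:
  "0 \<le> p \<Longrightarrow> f \<in> Lp p M \<Longrightarrow> g \<in> Lp p M \<Longrightarrow> (\<lambda>x. f x - g x) \<in> Lp p M"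
  using Lp_add[of p f M "\<lambda>x. - 1 * g x"] Lp_scale[of g p M "- 1"] by simp

lemma mult_op_Lp:
  assumes "0 \<le> p" "f \<in> Lp p M" "A \<in> sets M"
  shows "mult_op A f \<in> Lp p M"
proof (rule Lp_dominated[OF assms(1,2)])
  show "mult_op A f \<in> borel_measurable M"
    using Lp_borel[OF assms(2)] assms(3) unfolding mult_op_def by measurable
qed (auto simp: mult_op_def indicator_def)

lemma Lp_norm_nonneg: "0 \<le> Lp_norm p M f"
  by (simp add: Lp_norm_def)

lemma Lp_norm_powr:
  "0 < p \<Longrightarrow> Lp_norm p M f powr p = (LINT x|M. cmod (f x) powr p)"
  by (simp add: Lp_norm_def powr_powr)

lemma Lp_norm_mono:
  assumes "0 < p" "f \<in> Lp p M" "g \<in> Lp p M" "AE x in M. cmod (f x) \<le> cmod (g x)"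
  shows "Lp_norm p M f \<le> Lp_norm p M g"
proof -
  have "(LINT x|M. cmod (f x) powr p) \<le> (LINT x|M. cmod (g x) powr p)"
  proof (rule integral_mono_AE[OF assms(2,3)[THEN Lp_integrable]])
    show "AE x in M. cmod (f x) powr p \<le> cmod (g x) powr p"
      using assms(4) by eventually_elim (use assms(1) in \<open>auto intro!: powr_mono2\<close>)
  qed
  thus ?thesis unfolding Lp_norm_def using assms(1) by (intro powr_mono2) auto
qed

lemma Lp_norm_cong:
  assumes "0 < p" "f \<in> Lp p M" "g \<in> Lp p M" "AE x in M. cmod (f x) = cmod (g x)"
  shows "Lp_norm p M f = Lp_norm p M g"
  using assms by (intro antisym Lp_norm_mono) auto

lemma Lp_norm_scale:
  assumes "0 < p"
  shows "Lp_norm p M (\<lambda>x. c * f x) = cmod c * Lp_norm p M f"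
proof -
  have "Lp_norm p M (\<lambda>x. c * f x) = (cmod c powr p * (LINT x|M. cmod (f x) powr p)) powr (1 / p)"
    by (simp add: Lp_norm_def norm_mult powr_mult)
  thus ?thesis using assms by (simp add: Lp_norm_def powr_mult powr_powr)
qed

lemma Lp_norm_zero: "Lp_norm p M (\<lambda>x. 0) = 0"
  by (simp add: Lp_norm_def)

lemma Lp_norm_eq_0_iff:
  assumes "0 < p" "f \<in> Lp p M"
  shows "Lp_norm p M f = 0 \<longleftrightarrow> (AE x in M. f x = 0)"
  using integral_nonneg_eq_0_iff_AE[OF Lp_integrable[OF assms(2)]] assms(1)
  by (simp add: Lp_norm_def)

text \<open>A quasi-triangle inequality is enough for boundedness and uniqueness of limits. Its constant
  comes from \<open>|f + g| \<le> 2 max(|f|, |g|)\<close> and \<open>max(|f|, |g|)\<^sup>p \<le> |f|\<^sup>p + |g|\<^sup>p\<close>.\<close>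

lemma Lp_norm_add_le:
  assumes "0 < p" "f \<in> Lp p M" "g \<in> Lp p M"
  shows "Lp_norm p M (\<lambda>x. f x + g x) \<le> 2 * 2 powr (1 / p) * max (Lp_norm p M f) (Lp_norm p M g)"
proof -
  define m where "m x = complex_of_real (max (cmod (f x)) (cmod (g x)))" for x
  note [measurable] = assms(2,3)[THEN Lp_borel]
  have le: "cmod (m x) powr p \<le> cmod (f x) powr p + cmod (g x) powr p" for x
    by (auto simp: m_def max_def)
  have m_borel [measurable]: "m \<in> borel_measurable M" unfolding m_def by measurable
  have m: "m \<in> Lp p M"
    unfolding Lp_def
  proof (intro CollectI conjI m_borel)
    show "integrable M (\<lambda>x. cmod (m x) powr p)"
      by (rule Bochner_Integration.integrable_bound
          [OF Bochner_Integration.integrable_add[OF assms(2,3)[THEN Lp_integrable]]])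
        (use le in auto)
  qed
  have "Lp_norm p M (\<lambda>x. f x + g x) \<le> Lp_norm p M (\<lambda>x. 2 * m x)"
  proof (rule Lp_norm_mono)
    show "AE x in M. cmod (f x + g x) \<le> cmod (2 * m x)"
    proof (rule AE_I2)
      fix x
      show "cmod (f x + g x) \<le> cmod (2 * m x)"
        using norm_triangle_ineq[of "f x" "g x"] unfolding m_def norm_mult norm_of_real by simp
    qed
  qed (use assms m in \<open>auto intro!: Lp_add Lp_scale\<close>)
  also have "\<dots> = 2 * Lp_norm p M m" using Lp_norm_scale[OF assms(1), of M 2 m] by simp
  also have "Lp_norm p M m \<le> 2 powr (1 / p) * max (Lp_norm p M f) (Lp_norm p M g)"
  proof -
    have "Lp_norm p M m powr p \<le> Lp_norm p M f powr p + Lp_norm p M g powr p"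
      unfolding Lp_norm_powr[OF assms(1)]
      using integral_mono[OF Lp_integrable[OF m]
          Bochner_Integration.integrable_add[OF assms(2,3)[THEN Lp_integrable]] le]
        Bochner_Integration.integral_add[OF assms(2,3)[THEN Lp_integrable]] by simp
    also have "\<dots> \<le> 2 * max (Lp_norm p M f) (Lp_norm p M g) powr p"
      using powr_mono2[of p "Lp_norm p M f" "Lp_norm p M g"]
        powr_mono2[of p "Lp_norm p M g" "Lp_norm p M f"] assms(1) Lp_norm_nonneg
      by (auto simp: max_def)
    finally have "(Lp_norm p M m powr p) powr (1 / p)
        \<le> (2 * max (Lp_norm p M f) (Lp_norm p M g) powr p) powr (1 / p)"
      using assms(1) by (intro powr_mono2) auto
    thus ?thesis
      using assms(1) Lp_norm_nonneg[of p M] by (simp add: powr_mult powr_powr le_max_iff_disj)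
  qed
  finally show ?thesis by simp
qed

section \<open>Bounded operators and their norms\<close>

lemma Lp_operatorI:
  assumes "\<And>\<xi>. \<xi> \<in> Lp p M \<Longrightarrow> T \<xi> \<in> Lp p M"
    and "\<And>\<xi> \<eta>. \<xi> \<in> Lp p M \<Longrightarrow> \<eta> \<in> Lp p M \<Longrightarrow> AE x in M. \<xi> x = \<eta> x \<Longrightarrow> AE x in M. T \<xi> x = T \<eta> x"
    and "\<And>\<xi> \<eta>. \<xi> \<in> Lp p M \<Longrightarrow> \<eta> \<in> Lp p M \<Longrightarrow> AE x in M. T (\<lambda>x. \<xi> x + \<eta> x) x = T \<xi> x + T \<eta> x"
    and "\<And>c \<xi>. \<xi> \<in> Lp p M \<Longrightarrow> AE x in M. T (\<lambda>x. c * \<xi> x) x = c * T \<xi> x"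
    and "\<And>\<xi>. \<xi> \<in> Lp p M \<Longrightarrow> Lp_norm p M (T \<xi>) \<le> C * Lp_norm p M \<xi>"
  shows "Lp_operator p M T"
  unfolding Lp_operator_def using assms by (intro conjI allI ballI impI exI[of _ C])

lemma Lp_operator_in: "Lp_operator p M T \<Longrightarrow> \<xi> \<in> Lp p M \<Longrightarrow> T \<xi> \<in> Lp p M"
  by (auto simp: Lp_operator_def)

lemma Lp_operator_cong:
  "Lp_operator p M T \<Longrightarrow> \<xi> \<in> Lp p M \<Longrightarrow> \<eta> \<in> Lp p M \<Longrightarrow> AE x in M. \<xi> x = \<eta> x \<Longrightarrow>
    AE x in M. T \<xi> x = T \<eta> x"
  by (auto simp: Lp_operator_def)

lemma Lp_operator_add:
  "Lp_operator p M T \<Longrightarrow> \<xi> \<in> Lp p M \<Longrightarrow> \<eta> \<in> Lp p M \<Longrightarrow>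
    AE x in M. T (\<lambda>x. \<xi> x + \<eta> x) x = T \<xi> x + T \<eta> x"
  by (auto simp: Lp_operator_def)

lemma Lp_operator_scale:
  "Lp_operator p M T \<Longrightarrow> \<xi> \<in> Lp p M \<Longrightarrow> AE x in M. T (\<lambda>x. c * \<xi> x) x = c * T \<xi> x"
  by (auto simp: Lp_operator_def)

lemma Lp_operator_lincomb:
  assumes "Lp_operator p M T" "\<xi> \<in> Lp p M" "\<eta> \<in> Lp p M"
  shows "AE x in M. T (\<lambda>x. \<xi> x + c * \<eta> x) x = T \<xi> x + c * T \<eta> x"
  using Lp_operator_add[OF assms(1,2) Lp_scale[OF assms(3)], of c]
    Lp_operator_scale[OF assms(1,3), of c]
  by eventually_elim simp

lemma Lp_operator_diff:
  assumes "Lp_operator p M T" "\<xi> \<in> Lp p M" "\<eta> \<in> Lp p M"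
  shows "AE x in M. T (\<lambda>x. \<xi> x - \<eta> x) x = T \<xi> x - T \<eta> x"
  using Lp_operator_lincomb[OF assms, of "- 1"] by simp

lemma Lp_operator_bounded:
  assumes "Lp_operator p M T"
  obtains C where "0 \<le> C" "\<And>\<xi>. \<xi> \<in> Lp p M \<Longrightarrow> Lp_norm p M (T \<xi>) \<le> C * Lp_norm p M \<xi>"
proof -
  obtain C where C: "\<And>\<xi>. \<xi> \<in> Lp p M \<Longrightarrow> Lp_norm p M (T \<xi>) \<le> C * Lp_norm p M \<xi>"
    using assms unfolding Lp_operator_def by blast
  show thesis
  proof (rule that[of "max C 0"])
    fix \<xi> assume "\<xi> \<in> Lp p M"
    from C[OF this] show "Lp_norm p M (T \<xi>) \<le> max C 0 * Lp_norm p M \<xi>"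
      by (rule order_trans) (intro mult_right_mono Lp_norm_nonneg, simp)
  qed simp
qed

lemma Lp_operator_id: "Lp_operator p M (\<lambda>\<xi>. \<xi>)"
  unfolding Lp_operator_def by (auto intro!: exI[of _ 1])

lemma Lp_operator_comp:
  assumes p: "0 < p" and S: "Lp_operator p M S" and T: "Lp_operator p M T"
  shows "Lp_operator p M (\<lambda>\<xi>. S (T \<xi>))"
proof -
  note in_T = Lp_operator_in[OF T]
  obtain C where C: "0 \<le> C" "\<And>\<xi>. \<xi> \<in> Lp p M \<Longrightarrow> Lp_norm p M (S \<xi>) \<le> C * Lp_norm p M \<xi>"
    using S by (rule Lp_operator_bounded) blast
  obtain D where D: "0 \<le> D" "\<And>\<xi>. \<xi> \<in> Lp p M \<Longrightarrow> Lp_norm p M (T \<xi>) \<le> D * Lp_norm p M \<xi>"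
    using T by (rule Lp_operator_bounded) blast
  have "Lp_norm p M (S (T \<xi>)) \<le> C * D * Lp_norm p M \<xi>" if \<xi>: "\<xi> \<in> Lp p M" for \<xi>
    using C(2)[OF in_T[OF \<xi>]] mult_left_mono[OF D(2)[OF \<xi>] C(1)] by simp
  moreover have "AE x in M. S (T (\<lambda>x. \<xi> x + \<eta> x)) x = S (T \<xi>) x + S (T \<eta>) x"
    if \<xi>: "\<xi> \<in> Lp p M" and \<eta>: "\<eta> \<in> Lp p M" for \<xi> \<eta>
  proof -
    have "(\<lambda>x. \<xi> x + \<eta> x) \<in> Lp p M" "(\<lambda>x. T \<xi> x + T \<eta> x) \<in> Lp p M"
      using p \<xi> \<eta> by (auto intro!: Lp_add in_T)
    from Lp_operator_cong[OF S in_T[OF this(1)] this(2) Lp_operator_add[OF T \<xi> \<eta>]]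
      Lp_operator_add[OF S in_T[OF \<xi>] in_T[OF \<eta>]]
    show ?thesis by eventually_elim simp
  qed
  moreover have "AE x in M. S (T (\<lambda>x. c * \<xi> x)) x = c * S (T \<xi>) x"
    if \<xi>: "\<xi> \<in> Lp p M" for c \<xi>
    using Lp_operator_cong[OF S in_T[OF Lp_scale[OF \<xi>]] Lp_scale[OF in_T[OF \<xi>]]
        Lp_operator_scale[OF T \<xi>], of c]
      Lp_operator_scale[OF S in_T[OF \<xi>], of c] by eventually_elim simp
  moreover have "AE x in M. S (T \<xi>) x = S (T \<eta>) x"
    if "\<xi> \<in> Lp p M" "\<eta> \<in> Lp p M" "AE x in M. \<xi> x = \<eta> x" for \<xi> \<eta>
    using that by (intro Lp_operator_cong[OF S] Lp_operator_cong[OF T] in_T)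
  ultimately show ?thesis
    by (intro Lp_operatorI[where C = "C * D"] Lp_operator_in[OF S] in_T)
qed

lemma Lp_operator_linear_combination:
  assumes p: "0 < p" and S: "Lp_operator p M S" and T: "Lp_operator p M T"
  shows "Lp_operator p M (\<lambda>\<xi> x. a * S \<xi> x + b * T \<xi> x)" (is "Lp_operator p M ?R")
proof -
  note in_S = Lp_operator_in[OF S] and in_T = Lp_operator_in[OF T]
  obtain C where C: "0 \<le> C" "\<And>\<xi>. \<xi> \<in> Lp p M \<Longrightarrow> Lp_norm p M (S \<xi>) \<le> C * Lp_norm p M \<xi>"
    using S by (rule Lp_operator_bounded) blast
  obtain D where D: "0 \<le> D" "\<And>\<xi>. \<xi> \<in> Lp p M \<Longrightarrow> Lp_norm p M (T \<xi>) \<le> D * Lp_norm p M \<xi>"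
    using T by (rule Lp_operator_bounded) blast
  let ?K = "2 * 2 powr (1 / p) * max (cmod a * C) (cmod b * D)"
  have "Lp_norm p M (?R \<xi>) \<le> ?K * Lp_norm p M \<xi>" if \<xi>: "\<xi> \<in> Lp p M" for \<xi>
  proof -
    have "Lp_norm p M (?R \<xi>) \<le> 2 * 2 powr (1 / p) *
        max (Lp_norm p M (\<lambda>x. a * S \<xi> x)) (Lp_norm p M (\<lambda>x. b * T \<xi> x))"
      using p \<xi> by (intro Lp_norm_add_le Lp_scale in_S in_T)
    also have "max (Lp_norm p M (\<lambda>x. a * S \<xi> x)) (Lp_norm p M (\<lambda>x. b * T \<xi> x))
        \<le> max (cmod a * C * Lp_norm p M \<xi>) (cmod b * D * Lp_norm p M \<xi>)"
      unfolding Lp_norm_scale[OF p] mult.assoc using \<xi>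
      by (intro max.mono mult_left_mono C D) auto
    also have "\<dots> = max (cmod a * C) (cmod b * D) * Lp_norm p M \<xi>"
      using Lp_norm_nonneg[of p M \<xi>] by (simp add: max_mult_distrib_right)
    finally show ?thesis by simp
  qed
  moreover have "AE x in M. ?R (\<lambda>x. \<xi> x + \<eta> x) x = ?R \<xi> x + ?R \<eta> x"
    if \<xi>: "\<xi> \<in> Lp p M" and \<eta>: "\<eta> \<in> Lp p M" for \<xi> \<eta>
    using Lp_operator_add[OF S \<xi> \<eta>] Lp_operator_add[OF T \<xi> \<eta>]
    by eventually_elim (simp add: algebra_simps)
  moreover have "AE x in M. ?R (\<lambda>x. c * \<xi> x) x = c * ?R \<xi> x" if \<xi>: "\<xi> \<in> Lp p M" for c \<xi>
    using Lp_operator_scale[OF S \<xi>, of c] Lp_operator_scale[OF T \<xi>, of c]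
    by eventually_elim (simp add: algebra_simps)
  moreover have "AE x in M. ?R \<xi> x = ?R \<eta> x"
    if "\<xi> \<in> Lp p M" "\<eta> \<in> Lp p M" "AE x in M. \<xi> x = \<eta> x" for \<xi> \<eta>
    using Lp_operator_cong[OF S that] Lp_operator_cong[OF T that] by eventually_elim simp
  moreover have "?R \<xi> \<in> Lp p M" if "\<xi> \<in> Lp p M" for \<xi>
    using p that by (intro Lp_add Lp_scale in_S in_T) auto
  ultimately show ?thesis
    by (intro Lp_operatorI[where C = ?K])
qed

lemma Lp_operator_diff_op:
  assumes "0 < p" "Lp_operator p M S" "Lp_operator p M T"
  shows "Lp_operator p M (\<lambda>\<xi> x. S \<xi> x - T \<xi> x)"
  using Lp_operator_linear_combination[OF assms, of 1 "- 1"] by simp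

lemma Lp_operator_scale_op:
  assumes "0 < p" "Lp_operator p M T"
  shows "Lp_operator p M (\<lambda>\<xi> x. a * T \<xi> x)"
  using Lp_operator_linear_combination[OF assms assms(2), of a 0] by simp

lemma Lp_operator_power:
  assumes "0 < p" "Lp_operator p M T"
  shows "Lp_operator p M (T ^^ n)"
proof (induction n)
  case 0
  show ?case using Lp_operator_id[of p M] by (simp add: id_def)
next
  case (Suc n)
  from Lp_operator_comp[OF assms Suc] show ?case by (simp add: o_def)
qed

lemma Lp_operator_exp_partial_sum:
  assumes "0 < p" "Lp_operator p M T"
  shows "Lp_operator p M (\<lambda>\<xi> x. \<Sum>k<n. (T ^^ k) \<xi> x / fact k)"
proof (induction n)
  case 0
  show ?case using Lp_operator_scale_op[OF assms, of 0] by simp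
next
  case (Suc n)
  from Lp_operator_linear_combination[OF assms(1) Suc Lp_operator_power[OF assms, of n], of 1 "1 / fact n"]
  show ?case by simp
qed

lemma Lp_unit_ball_nonempty: "{\<xi> \<in> Lp p M. Lp_norm p M \<xi> \<le> 1} \<noteq> {}"
proof -
  have "(\<lambda>x. 0) \<in> {\<xi> \<in> Lp p M. Lp_norm p M \<xi> \<le> 1}" by (simp add: Lp_zero Lp_norm_zero)
  thus ?thesis by blast
qed

lemma Lp_opnorm_le:
  assumes "\<And>\<xi>. \<xi> \<in> Lp p M \<Longrightarrow> Lp_norm p M \<xi> \<le> 1 \<Longrightarrow> Lp_norm p M (T \<xi>) \<le> K"
  shows "Lp_opnorm p M T \<le> K"
  unfolding Lp_opnorm_def using Lp_unit_ball_nonempty[of p M] assms by (intro cSUP_least) auto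

lemma Lp_norm_le_opnorm:
  assumes "Lp_operator p M T" "\<xi> \<in> Lp p M" "Lp_norm p M \<xi> \<le> 1"
  shows "Lp_norm p M (T \<xi>) \<le> Lp_opnorm p M T"
proof -
  obtain C where C: "0 \<le> C" "\<And>\<xi>. \<xi> \<in> Lp p M \<Longrightarrow> Lp_norm p M (T \<xi>) \<le> C * Lp_norm p M \<xi>"
    using assms(1) by (rule Lp_operator_bounded) blast
  have "Lp_norm p M (T \<eta>) \<le> C" if "\<eta> \<in> Lp p M" "Lp_norm p M \<eta> \<le> 1" for \<eta>
    using C(2)[OF that(1)] mult_left_mono[OF that(2) C(1)] by simp
  thus ?thesis
    unfolding Lp_opnorm_def using assms(2,3) by (intro cSUP_upper bdd_aboveI2[where M = C]) auto
qed

lemma Lp_opnorm_nonneg: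
  assumes "Lp_operator p M T"
  shows "0 \<le> Lp_opnorm p M T"
  using Lp_norm_le_opnorm[OF assms Lp_zero] Lp_norm_nonneg[of p M "T (\<lambda>x. 0)"]
  by (simp add: Lp_norm_zero)

lemma Lp_norm_operator_le:
  assumes p: "0 < p" and T: "Lp_operator p M T" and \<xi>: "\<xi> \<in> Lp p M"
  shows "Lp_norm p M (T \<xi>) \<le> Lp_opnorm p M T * Lp_norm p M \<xi>"
proof (cases "Lp_norm p M \<xi> = 0")
  case True
  obtain C where "Lp_norm p M (T \<xi>) \<le> C * Lp_norm p M \<xi>"
    using Lp_operator_bounded[OF T] \<xi> by blast
  thus ?thesis using True by simp
next
  case False
  let ?r = "Lp_norm p M \<xi>"
  have r: "?r > 0" using False Lp_norm_nonneg[of p M \<xi>] by simp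
  let ?\<eta> = "\<lambda>x. complex_of_real (1 / ?r) * \<xi> x"
  have \<eta>: "?\<eta> \<in> Lp p M" by (rule Lp_scale[OF \<xi>])
  have "Lp_norm p M ?\<eta> \<le> 1"
    unfolding Lp_norm_scale[OF p] norm_of_real using r by simp
  from Lp_norm_le_opnorm[OF T \<eta> this]
  have "Lp_norm p M (T ?\<eta>) \<le> Lp_opnorm p M T" .
  also have "Lp_norm p M (T ?\<eta>) = Lp_norm p M (\<lambda>x. complex_of_real (1 / ?r) * T \<xi> x)"
  proof (rule Lp_norm_cong[OF p])
    show "AE x in M. cmod (T ?\<eta> x) = cmod (complex_of_real (1 / ?r) * T \<xi> x)"
      using Lp_operator_scale[OF T \<xi>, of "complex_of_real (1 / ?r)"] by eventually_elim simp
  qed (intro Lp_operator_in[OF T \<eta>] Lp_scale Lp_operator_in[OF T \<xi>])+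
  also have "\<dots> = Lp_norm p M (T \<xi>) / ?r"
    unfolding Lp_norm_scale[OF p] norm_of_real using r by simp
  finally show ?thesis using r by (simp add: field_simps)
qed

lemma Lp_opnorm_cong:
  assumes p: "0 < p" and S: "Lp_operator p M S" and T: "Lp_operator p M T"
    and eq: "Lp_op_eq p M S T"
  shows "Lp_opnorm p M S = Lp_opnorm p M T"
proof -
  have "Lp_norm p M (S \<xi>) = Lp_norm p M (T \<xi>)" if \<xi>: "\<xi> \<in> Lp p M" for \<xi>
  proof (rule Lp_norm_cong[OF p Lp_operator_in[OF S \<xi>] Lp_operator_in[OF T \<xi>]])
    show "AE x in M. cmod (S \<xi> x) = cmod (T \<xi> x)"
      using eq \<xi> unfolding Lp_op_eq_def by (auto elim!: eventually_mono)
  qed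
  thus ?thesis unfolding Lp_opnorm_def by (intro SUP_cong) auto
qed

section \<open>The exponential of a multiple of an idempotent\<close>

lemma Lp_operator_limit_unique:
  assumes p: "0 < p"
    and R: "\<And>n. Lp_operator p M (R n)" and A: "Lp_operator p M A" and B: "Lp_operator p M B"
    and lim_A: "(\<lambda>n. Lp_opnorm p M (\<lambda>\<xi> x. R n \<xi> x - A \<xi> x)) \<longlonglongrightarrow> 0"
    and lim_B: "(\<lambda>n. Lp_opnorm p M (\<lambda>\<xi> x. R n \<xi> x - B \<xi> x)) \<longlonglongrightarrow> 0"
  shows "Lp_op_eq p M A B"
  unfolding Lp_op_eq_def
proof
  fix \<xi> assume \<xi>: "\<xi> \<in> Lp p M"
  let ?d = "\<lambda>x. B \<xi> x - A \<xi> x"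
  let ?a = "\<lambda>n. Lp_opnorm p M (\<lambda>\<xi> x. R n \<xi> x - A \<xi> x) * Lp_norm p M \<xi>"
  let ?b = "\<lambda>n. Lp_opnorm p M (\<lambda>\<xi> x. R n \<xi> x - B \<xi> x) * Lp_norm p M \<xi>"
  let ?K = "2 * 2 powr (1 / p)"
  have d: "?d \<in> Lp p M" using p \<xi> by (intro Lp_diff Lp_operator_in[OF A] Lp_operator_in[OF B]) auto
  have "Lp_norm p M ?d \<le> ?K * max (?a n) (?b n)" for n
  proof -
    let ?f = "\<lambda>x. R n \<xi> x - A \<xi> x" and ?g = "\<lambda>x. R n \<xi> x - B \<xi> x"
    have f: "?f \<in> Lp p M" and g: "?g \<in> Lp p M"
      using p \<xi> by (auto intro!: Lp_diff Lp_operator_in[OF A] Lp_operator_in[OF B] Lp_operator_in[OF R])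
    have "Lp_norm p M ?d = Lp_norm p M (\<lambda>x. ?f x + - 1 * ?g x)"
      by simp
    also have "\<dots> \<le> ?K * max (Lp_norm p M ?f) (Lp_norm p M (\<lambda>x. - 1 * ?g x))"
      using p f g by (intro Lp_norm_add_le Lp_scale)
    also have "Lp_norm p M (\<lambda>x. - 1 * ?g x) = Lp_norm p M ?g"
      unfolding Lp_norm_scale[OF p] by simp
    also have "?K * max (Lp_norm p M ?f) (Lp_norm p M ?g) \<le> ?K * max (?a n) (?b n)"
      using Lp_norm_operator_le[OF p Lp_operator_diff_op[OF p R A] \<xi>, of n]
        Lp_norm_operator_le[OF p Lp_operator_diff_op[OF p R B] \<xi>, of n]
      by (intro mult_left_mono max.mono) auto
    finally show ?thesis .
  qed
  moreover have "(\<lambda>n. ?K * max (?a n) (?b n)) \<longlonglongrightarrow> ?K * max (0 * Lp_norm p M \<xi>) (0 * Lp_norm p M \<xi>)"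
    by (intro tendsto_intros tendsto_max lim_A lim_B)
  ultimately have "Lp_norm p M ?d \<le> ?K * max (0 * Lp_norm p M \<xi>) (0 * Lp_norm p M \<xi>)"
    by (intro LIMSEQ_le_const) blast+
  hence "Lp_norm p M ?d \<le> 0" by simp
  hence "AE x in M. ?d x = 0"
    using Lp_norm_eq_0_iff[OF p d] Lp_norm_nonneg[of p M ?d] by simp
  thus "AE x in M. A \<xi> x = B \<xi> x" by eventually_elim simp
qed

text \<open>The closed form of \<open>exp (a e)\<close> for an idempotent \<open>e\<close>.\<close>

definition idempotent_exp :: "complex \<Rightarrow> 'a fun_op \<Rightarrow> 'a fun_op" where
  "idempotent_exp a e = (\<lambda>\<xi> x. \<xi> x + (exp a - 1) * e \<xi> x)"

lemma Lp_operator_idempotent_exp: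
  assumes "0 < p" "Lp_operator p M e"
  shows "Lp_operator p M (idempotent_exp a e)"
  using Lp_operator_linear_combination[OF assms(1) Lp_operator_id assms(2), of 1 "exp a - 1"]
  by (simp add: idempotent_exp_def)

lemma idempotentD:
  "Lp_idempotent p M e \<Longrightarrow> \<xi> \<in> Lp p M \<Longrightarrow> AE x in M. e (e \<xi>) x = e \<xi> x"
  by (simp add: Lp_idempotent_def Lp_op_eq_def)

lemma idempotent_multiple_power:
  assumes p: "0 < p" and e: "Lp_operator p M e" and idem: "Lp_idempotent p M e"
    and \<xi>: "\<xi> \<in> Lp p M"
  shows "AE x in M. ((\<lambda>\<xi> x. a * e \<xi> x) ^^ Suc k) \<xi> x = a ^ Suc k * e \<xi> x"
proof (induction k)
  case (Suc k)
  let ?T = "\<lambda>\<xi> x. a * e \<xi> x"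
  let ?\<eta> = "(?T ^^ Suc k) \<xi>"
  have \<eta>: "?\<eta> \<in> Lp p M"
    by (rule Lp_operator_in[OF Lp_operator_power[OF p Lp_operator_scale_op[OF p e]] \<xi>])
  from Lp_operator_cong[OF e \<eta> Lp_scale[OF Lp_operator_in[OF e \<xi>]] Suc]
    Lp_operator_scale[OF e Lp_operator_in[OF e \<xi>], of "a ^ Suc k"] idempotentD[OF idem \<xi>]
  show ?case by eventually_elim simp
qed simp

text \<open>For an idempotent the exponential series collapses: every positive power of \<open>a e\<close> is a multiple
  of \<open>e\<close>, and the scalar factors add up to \<open>exp a - 1\<close>.\<close>

lemma Lp_has_exp_idempotent:
  assumes p: "0 < p" and e: "Lp_operator p M e" and idem: "Lp_idempotent p M e"
  shows "Lp_has_exp p M (\<lambda>\<xi> x. a * e \<xi> x) (idempotent_exp a e)"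
proof -
  let ?T = "\<lambda>\<xi> x. a * e \<xi> x"
  let ?S = "\<lambda>n \<xi> x. \<Sum>k<n. (?T ^^ k) \<xi> x / fact k"
  let ?E = "\<lambda>n. \<Sum>k<n. a ^ k / fact k"
  let ?D = "\<lambda>n \<xi> x. ?S n \<xi> x - idempotent_exp a e \<xi> x"
  have D: "Lp_operator p M (?D n)" for n
    by (intro Lp_operator_diff_op Lp_operator_exp_partial_sum Lp_operator_scale_op
        Lp_operator_idempotent_exp p e)
  have D_Suc: "Lp_op_eq p M (?D (Suc n)) (\<lambda>\<xi> x. (?E (Suc n) - exp a) * e \<xi> x)" for n
    unfolding Lp_op_eq_def
  proof
    fix \<xi> assume \<xi>: "\<xi> \<in> Lp p M"
    have "AE x in M. \<forall>k. (?T ^^ Suc k) \<xi> x = a ^ Suc k * e \<xi> x"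
      by (simp only: AE_all_countable) (intro allI idempotent_multiple_power[OF p e idem \<xi>])
    thus "AE x in M. ?D (Suc n) \<xi> x = (?E (Suc n) - exp a) * e \<xi> x"
    proof eventually_elim
      case (elim x)
      have "?S (Suc n) \<xi> x = \<xi> x + (\<Sum>k<n. (?T ^^ Suc k) \<xi> x / fact (Suc k))"
        by (subst sum.lessThan_Suc_shift) (simp del: funpow.simps(2) fact_Suc)
      also have "\<dots> = \<xi> x + (\<Sum>k<n. a ^ Suc k / fact (Suc k)) * e \<xi> x"
        unfolding elim[rule_format] sum_distrib_right by (simp del: fact_Suc)
      also have "(\<Sum>k<n. a ^ Suc k / fact (Suc k)) = ?E (Suc n) - 1"
        by (subst sum.lessThan_Suc_shift) (simp del: fact_Suc)
      finally show ?case by (simp add: idempotent_exp_def algebra_simps)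
    qed
  qed
  have "(\<lambda>n. ?E (Suc n)) \<longlonglongrightarrow> exp a"
    using exp_converges[of a] unfolding sums_def
    by (subst filterlim_sequentially_Suc) (simp add: scaleR_conv_of_real field_simps)
  hence "(\<lambda>n. cmod (?E (Suc n) - exp a) * Lp_opnorm p M e) \<longlonglongrightarrow> cmod (exp a - exp a) * Lp_opnorm p M e"
    by (intro tendsto_intros)
  hence lim: "(\<lambda>n. cmod (?E (Suc n) - exp a) * Lp_opnorm p M e) \<longlonglongrightarrow> 0" by simp
  have upper: "Lp_opnorm p M (?D (Suc n)) \<le> cmod (?E (Suc n) - exp a) * Lp_opnorm p M e" for n
  proof -
    have "Lp_opnorm p M (?D (Suc n)) = Lp_opnorm p M (\<lambda>\<xi> x. (?E (Suc n) - exp a) * e \<xi> x)"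
      by (rule Lp_opnorm_cong[OF p D Lp_operator_scale_op[OF p e] D_Suc])
    also have "\<dots> \<le> cmod (?E (Suc n) - exp a) * Lp_opnorm p M e"
      unfolding Lp_norm_scale[OF p]
      by (intro Lp_opnorm_le, unfold Lp_norm_scale[OF p]) (intro mult_left_mono Lp_norm_le_opnorm[OF e], auto)
    finally show ?thesis .
  qed
  have "(\<lambda>n. Lp_opnorm p M (?D (Suc n))) \<longlonglongrightarrow> 0"
  proof (rule tendsto_sandwich[OF _ _ tendsto_const lim])
    show "\<forall>\<^sub>F n in sequentially. 0 \<le> Lp_opnorm p M (?D (Suc n))"
      by (intro always_eventually allI Lp_opnorm_nonneg D)
    show "\<forall>\<^sub>F n in sequentially. Lp_opnorm p M (?D (Suc n))
        \<le> cmod (?E (Suc n) - exp a) * Lp_opnorm p M e"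
      by (intro always_eventually allI upper)
  qed
  hence "(\<lambda>n. Lp_opnorm p M (?D n)) \<longlonglongrightarrow> 0" by (subst (asm) filterlim_sequentially_Suc)
  thus ?thesis
    unfolding Lp_has_exp_def using Lp_operator_idempotent_exp[OF p e] by simp
qed

lemma Lp_exp_idempotent:
  assumes p: "0 < p" and e: "Lp_operator p M e" and idem: "Lp_idempotent p M e"
  shows "Lp_operator p M (Lp_exp p M (\<lambda>\<xi> x. a * e \<xi> x))"
    and "Lp_op_eq p M (Lp_exp p M (\<lambda>\<xi> x. a * e \<xi> x)) (idempotent_exp a e)"
proof -
  let ?T = "\<lambda>\<xi> x. a * e \<xi> x"
  have has: "Lp_has_exp p M ?T (Lp_exp p M ?T)"
    unfolding Lp_exp_def by (rule someI[of "Lp_has_exp p M ?T", OF Lp_has_exp_idempotent[OF assms]])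
  thus "Lp_operator p M (Lp_exp p M ?T)" by (simp add: Lp_has_exp_def)
  show "Lp_op_eq p M (Lp_exp p M ?T) (idempotent_exp a e)"
    using has Lp_has_exp_idempotent[OF assms, of a]
    by (intro Lp_operator_limit_unique[OF p
          Lp_operator_exp_partial_sum[OF p Lp_operator_scale_op[OF p e]]])
       (auto simp: Lp_has_exp_def)
qed

lemma Lp_opnorm_exp_idempotent:
  assumes "0 < p" "Lp_operator p M e" "Lp_idempotent p M e"
  shows "Lp_opnorm p M (Lp_exp p M (\<lambda>\<xi> x. a * e \<xi> x)) = Lp_opnorm p M (idempotent_exp a e)"
  using assms by (intro Lp_opnorm_cong Lp_exp_idempotent Lp_operator_idempotent_exp)

section \<open>Local idempotents are multiplication operators\<close>

definition Lp_local :: "real \<Rightarrow> 'a measure \<Rightarrow> 'a fun_op \<Rightarrow> bool" where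
  "Lp_local p M T \<longleftrightarrow> (\<forall>\<xi>\<in>Lp p M. AE x in M. \<xi> x = 0 \<longrightarrow> T \<xi> x = 0)"

lemma Lp_localD: "Lp_local p M T \<Longrightarrow> \<xi> \<in> Lp p M \<Longrightarrow> AE x in M. \<xi> x = 0 \<longrightarrow> T \<xi> x = 0"
  by (simp add: Lp_local_def)

lemma Lp_local_commutes_mult_op:
  assumes p: "0 < p" and T: "Lp_operator p M T" and loc: "Lp_local p M T"
    and \<xi>: "\<xi> \<in> Lp p M" and A: "A \<in> sets M"
  shows "AE x in M. T (mult_op A \<xi>) x = mult_op A (T \<xi>) x"
proof -
  let ?f = "mult_op A \<xi>" and ?g = "mult_op (space M - A) \<xi>"
  have f: "?f \<in> Lp p M" and g: "?g \<in> Lp p M"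
    using p \<xi> A by (auto intro!: mult_op_Lp)
  have "AE x in M. ?f x + ?g x = \<xi> x"
    by (rule AE_I2) (auto simp: mult_op_def indicator_def)
  moreover have "(\<lambda>x. ?f x + ?g x) \<in> Lp p M" using p f g by (intro Lp_add) auto
  ultimately have "AE x in M. T (\<lambda>x. ?f x + ?g x) x = T \<xi> x"
    using \<xi> by (intro Lp_operator_cong[OF T])
  with Lp_operator_add[OF T f g] Lp_localD[OF loc f] Lp_localD[OF loc g] AE_space
  show ?thesis
  proof eventually_elim
    case (elim x)
    thus ?case by (cases "x \<in> A") (auto simp: mult_op_def)
  qed
qed

text \<open>Where \<open>u\<close> and \<open>v\<close> are both nonzero, \<open>u\<close> is on small pieces nearly a constant multiple
  \<open>c v\<close>. On such a piece a local operator fixes \<open>u\<close> and sends \<open>u - c v\<close> to \<open>u\<close>, although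
  \<open>u - c v\<close> is much smaller than \<open>u\<close>; boundedness makes the piece a null set.\<close>

lemma Lp_local_fixed_kernel_disjoint:
  assumes p: "0 < p" and T: "Lp_operator p M T" and loc: "Lp_local p M T"
    and u: "u \<in> Lp p M" and v: "v \<in> Lp p M"
    and Tu: "AE x in M. T u x = u x" and Tv: "AE x in M. T v x = 0"
  shows "AE x in M. u x = 0 \<or> v x = 0"
proof -
  note [measurable] = u[THEN Lp_borel] v[THEN Lp_borel]
  obtain C where C: "0 \<le> C" "\<And>\<xi>. \<xi> \<in> Lp p M \<Longrightarrow> Lp_norm p M (T \<xi>) \<le> C * Lp_norm p M \<xi>"
    using T by (rule Lp_operator_bounded) blast
  \<comment> \<open>On \<open>A c\<close> the operator bound \<open>C\<close> applied to \<open>u - c v\<close> still stays below half of \<open>u\<close>.\<close>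
  define A where "A c = {x \<in> space M. u x \<noteq> 0 \<and> 2 * (C * cmod (u x - c * v x)) \<le> cmod (u x)}" for c
  have A [measurable]: "A c \<in> sets M" for c unfolding A_def by measurable
  have null: "AE x in M. x \<notin> A c" for c
  proof -
    let ?h = "\<lambda>x. u x - c * v x"
    let ?d = "mult_op (A c) ?h" and ?m = "mult_op (A c) u"
    have h: "?h \<in> Lp p M" using p u v by (intro Lp_diff Lp_scale) auto
    have d: "?d \<in> Lp p M" and m: "?m \<in> Lp p M"
      using p h u A by (auto intro!: mult_op_Lp)
    have "AE x in M. T ?d x = ?m x"
      using Lp_local_commutes_mult_op[OF p T loc h A] Lp_operator_lincomb[OF T u v, of "- c"] Tu Tv
      by eventually_elim (simp add: mult_op_def)
    hence "Lp_norm p M ?m = Lp_norm p M (T ?d)"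
      by (intro Lp_norm_cong[OF p m Lp_operator_in[OF T d]]) (auto elim: eventually_mono)
    also have "\<dots> \<le> C * Lp_norm p M ?d" by (rule C(2)[OF d])
    also have "\<dots> = Lp_norm p M (\<lambda>x. complex_of_real C * ?d x)"
      unfolding Lp_norm_scale[OF p] using C(1) by simp
    also have "\<dots> \<le> Lp_norm p M (\<lambda>x. 1 / 2 * ?m x)"
    proof (rule Lp_norm_mono[OF p Lp_scale[OF d] Lp_scale[OF m]], rule AE_I2)
      fix x
      show "cmod (complex_of_real C * ?d x) \<le> cmod (1 / 2 * ?m x)"
        using C(1) by (cases "x \<in> A c") (auto simp: mult_op_def A_def norm_mult)
    qed
    also have "\<dots> = Lp_norm p M ?m / 2"
      unfolding Lp_norm_scale[OF p] by simp
    finally have "Lp_norm p M ?m = 0" using Lp_norm_nonneg[of p M ?m] by simp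
    hence "AE x in M. ?m x = 0" using Lp_norm_eq_0_iff[OF p m] by simp
    thus ?thesis by eventually_elim (auto simp: mult_op_def A_def)
  qed
  obtain D :: "complex set" where D: "countable D"
    "\<And>X. open X \<Longrightarrow> X \<noteq> {} \<Longrightarrow> \<exists>d\<in>D. d \<in> X"
    using countable_dense_setE by blast
  have "AE x in M. \<forall>c\<in>D. x \<notin> A c" using D(1) null by (intro AE_ball_countable') auto
  with AE_space show ?thesis
  proof eventually_elim
    case (elim x)
    show ?case
    proof (rule ccontr)
      assume "\<not> (u x = 0 \<or> v x = 0)"
      hence nz: "u x \<noteq> 0" "v x \<noteq> 0" by auto
      define K where "K = C + 1"
      have K: "0 < K" "C \<le> K" using C(1) by (auto simp: K_def)
      define r where "r = cmod (u x) / (2 * K * cmod (v x))"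
      have "r > 0" using nz K(1) by (simp add: r_def)
      hence "ball (u x / v x) r \<noteq> {}" by simp
      from D(2)[OF open_ball this] obtain c where c: "c \<in> D" "c \<in> ball (u x / v x) r" by blast
      have "cmod (u x - c * v x) = cmod (u x / v x - c) * cmod (v x)"
        using nz by (simp add: left_diff_distrib flip: norm_mult)
      also have "\<dots> \<le> r * cmod (v x)"
        using c(2) by (intro mult_right_mono) (auto simp: dist_norm)
      finally have "C * cmod (u x - c * v x) \<le> K * (r * cmod (v x))"
        using K by (intro mult_mono) auto
      also have "\<dots> = cmod (u x) / 2" using nz K(1) by (simp add: r_def)
      finally have "x \<in> A c" using elim(1) nz by (simp add: A_def)
      thus False using elim(2) c(1) by blast
    qed
  qed
qed

lemma Lp_nowhere_zero_exists:
  assumes "0 < p" "sigma_finite_measure M"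
  obtains w where "w \<in> Lp p M" "\<And>x. x \<in> space M \<Longrightarrow> w x \<noteq> 0"
proof -
  obtain h :: "'a \<Rightarrow> ennreal" where h [measurable]: "h \<in> borel_measurable M"
    and fin: "integral\<^sup>N M h \<noteq> \<infinity>" and pos: "\<And>x. x \<in> space M \<Longrightarrow> 0 < h x \<and> h x < \<infinity>"
    using sigma_finite_measure.Ex_finite_integrable_function[OF assms(2)] by blast
  define w where "w x = complex_of_real (enn2real (h x) powr (1 / p))" for x
  have w_powr: "cmod (w x) powr p = enn2real (h x)" for x
    using assms(1) by (simp add: w_def powr_powr)
  have "w \<in> Lp p M"
    unfolding Lp_def
  proof (intro CollectI conjI)
    show "w \<in> borel_measurable M" unfolding w_def by measurable
    have "(\<integral>\<^sup>+x. ennreal (enn2real (h x)) \<partial>M) = integral\<^sup>N M h"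
      using pos by (intro nn_integral_cong) simp
    thus "integrable M (\<lambda>x. cmod (w x) powr p)"
      unfolding w_powr using fin by (intro integrableI_nonneg) (auto simp: less_top)
  qed
  moreover have "w x \<noteq> 0" if "x \<in> space M" for x
    using pos[OF that] by (auto simp: w_def enn2real_eq_0_iff)
  ultimately show thesis by (rule that)
qed

text \<open>The range and the kernel of a local idempotent consist of functions with disjoint supports.
  The two components of a nowhere vanishing function therefore split the space into the set \<open>E\<close> that
  carries the range and the set that carries the kernel.\<close>

lemma Lp_local_idempotent_is_mult_op:
  assumes p: "0 < p" and \<sigma>: "sigma_finite_measure M" and e: "Lp_operator p M e"
    and idem: "Lp_idempotent p M e" and loc: "Lp_local p M e"
  shows "\<exists>E\<in>sets M. Lp_op_eq p M e (mult_op E)"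
proof -
  obtain w where w: "w \<in> Lp p M" and w_nz: "\<And>x. x \<in> space M \<Longrightarrow> w x \<noteq> 0"
    using Lp_nowhere_zero_exists[OF p \<sigma>] by blast
  define E where "E = {x \<in> space M. e w x \<noteq> 0}"
  have disj: "AE x in M. e \<xi> x = 0 \<or> \<eta> x - e \<eta> x = 0"
    if \<xi>: "\<xi> \<in> Lp p M" and \<eta>: "\<eta> \<in> Lp p M" for \<xi> \<eta>
  proof (rule Lp_local_fixed_kernel_disjoint[OF p e loc])
    show "(\<lambda>x. \<eta> x - e \<eta> x) \<in> Lp p M" using p \<eta> by (intro Lp_diff Lp_operator_in[OF e]) auto
    show "AE x in M. e (\<lambda>x. \<eta> x - e \<eta> x) x = 0"
      using Lp_operator_diff[OF e \<eta> Lp_operator_in[OF e \<eta>]] idempotentD[OF idem \<eta>]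
      by eventually_elim simp
  qed (use \<xi> in \<open>auto intro: Lp_operator_in[OF e] idempotentD[OF idem]\<close>)
  have "Lp_op_eq p M e (mult_op E)"
    unfolding Lp_op_eq_def
  proof
    fix \<xi> assume \<xi>: "\<xi> \<in> Lp p M"
    from disj[OF w w] disj[OF \<xi> w] disj[OF w \<xi>] AE_space
    show "AE x in M. e \<xi> x = mult_op E \<xi> x"
    proof eventually_elim
      case (elim x)
      thus ?case using w_nz[of x] by (auto simp: mult_op_def E_def indicator_def)
    qed
  qed
  moreover have "E \<in> sets M"
    using Lp_borel[OF Lp_operator_in[OF e w]] unfolding E_def by measurable
  ultimately show ?thesis by blast
qed

section \<open>Hermitian idempotents\<close>

lemma integral_parallelogram_defect:
  assumes p: "0 < p" and f: "f \<in> Lp p M" and g: "g \<in> Lp p M"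
  shows "integrable M (\<lambda>x. parallelogram_defect p (f x) (g x))"
    and "(LINT x|M. parallelogram_defect p (f x) (g x)) =
      (if p < 2 then 1 else -1) *
      (2 * (Lp_norm p M f powr p + Lp_norm p M g powr p)
        - Lp_norm p M (\<lambda>x. f x + g x) powr p - Lp_norm p M (\<lambda>x. f x - g x) powr p)"
proof -
  have "(\<lambda>x. f x + g x) \<in> Lp p M" "(\<lambda>x. f x - g x) \<in> Lp p M"
    using assms by (auto intro!: Lp_add Lp_diff)
  note [simp] = this[THEN Lp_integrable] f[THEN Lp_integrable] g[THEN Lp_integrable]
  show "integrable M (\<lambda>x. parallelogram_defect p (f x) (g x))"
    unfolding parallelogram_defect_def by simp
  show "(LINT x|M. parallelogram_defect p (f x) (g x)) =
      (if p < 2 then 1 else -1) *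
      (2 * (Lp_norm p M f powr p + Lp_norm p M g powr p)
        - Lp_norm p M (\<lambda>x. f x + g x) powr p - Lp_norm p M (\<lambda>x. f x - g x) powr p)"
    unfolding parallelogram_defect_def Lp_norm_powr[OF p] by simp
qed

text \<open>The integrated parallelogram defect is expressed in norms, so isometries preserve it; it
  vanishes exactly for functions with disjoint supports (Lamperti).\<close>

lemma isometry_preserves_disjointness:
  assumes p: "1 \<le> p" "p \<noteq> 2" and U: "Lp_operator p M U"
    and iso: "\<And>\<xi>. \<xi> \<in> Lp p M \<Longrightarrow> Lp_norm p M (U \<xi>) = Lp_norm p M \<xi>"
    and f: "f \<in> Lp p M" and g: "g \<in> Lp p M" and disj: "AE x in M. f x = 0 \<or> g x = 0"
  shows "AE x in M. U f x = 0 \<or> U g x = 0"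
proof -
  have p0: "0 < p" using p by simp
  have sum: "(\<lambda>x. f x + g x) \<in> Lp p M" and diff: "(\<lambda>x. f x - g x) \<in> Lp p M"
    using p0 f g by (auto intro!: Lp_add Lp_diff)
  note Uf = Lp_operator_in[OF U f] and Ug = Lp_operator_in[OF U g]
  have Usum: "(\<lambda>x. U f x + U g x) \<in> Lp p M" and Udiff: "(\<lambda>x. U f x - U g x) \<in> Lp p M"
    using p0 Uf Ug by (auto intro!: Lp_add Lp_diff)
  have 1: "Lp_norm p M (\<lambda>x. U f x + U g x) = Lp_norm p M (\<lambda>x. f x + g x)"
    unfolding iso[OF sum, symmetric]
    by (rule Lp_norm_cong[OF p0 Usum Lp_operator_in[OF U sum]])
       (use Lp_operator_add[OF U f g] in \<open>eventually_elim, simp\<close>)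
  have 2: "Lp_norm p M (\<lambda>x. U f x - U g x) = Lp_norm p M (\<lambda>x. f x - g x)"
    unfolding iso[OF diff, symmetric]
    by (rule Lp_norm_cong[OF p0 Udiff Lp_operator_in[OF U diff]])
       (use Lp_operator_diff[OF U f g] in \<open>eventually_elim, simp\<close>)
  have "(LINT x|M. parallelogram_defect p (U f x) (U g x))
      = (LINT x|M. parallelogram_defect p (f x) (g x))"
    unfolding integral_parallelogram_defect(2)[OF p0 Uf Ug]
      integral_parallelogram_defect(2)[OF p0 f g] 1 2 iso[OF f] iso[OF g] ..
  also have "\<dots> = 0"
  proof (rule integral_eq_zero_AE)
    show "AE x in M. parallelogram_defect p (f x) (g x) = 0"
      using disj by eventually_elim (rule parallelogram_defect_0[OF p0])
  qed
  finally have "AE x in M. parallelogram_defect p (U f x) (U g x) = 0"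
    using integral_nonneg_eq_0_iff_AE[OF integral_parallelogram_defect(1)[OF p0 Uf Ug]]
      parallelogram_defect_nonneg[OF p] by simp
  thus ?thesis
    by eventually_elim (use parallelogram_defect_pos[OF p] in force)
qed

text \<open>Both \<open>exp (\<i> t e)\<close> and its inverse \<open>exp (- \<i> t e)\<close> are contractions, so they are isometries.\<close>

lemma hermitian_exp_isometry:
  assumes p: "0 < p" and e: "Lp_operator p M e" and idem: "Lp_idempotent p M e"
    and herm: "\<And>t::real. Lp_opnorm p M (idempotent_exp (\<i> * of_real t) e) = 1"
    and \<xi>: "\<xi> \<in> Lp p M"
  shows "Lp_norm p M (idempotent_exp (\<i> * of_real t) e \<xi>) = Lp_norm p M \<xi>"
proof -
  let ?U = "\<lambda>t::real. idempotent_exp (\<i> * of_real t) e"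
  note U = Lp_operator_idempotent_exp[OF p e]
  have contr: "Lp_norm p M (?U t \<eta>) \<le> Lp_norm p M \<eta>" if "\<eta> \<in> Lp p M" for \<eta> t
    using Lp_norm_operator_le[OF p U that, of "\<i> * of_real t"] herm[of t] by simp
  have inv: "AE x in M. ?U (- t) (?U t \<xi>) x = \<xi> x"
    using Lp_operator_lincomb[OF e \<xi> Lp_operator_in[OF e \<xi>], of "exp (\<i> * of_real t) - 1"]
      idempotentD[OF idem \<xi>]
  proof eventually_elim
    case (elim x)
    have "e (?U t \<xi>) x = exp (\<i> * of_real t) * e \<xi> x"
      using elim by (simp add: idempotent_exp_def algebra_simps)
    hence "?U (- t) (?U t \<xi>) x =
        \<xi> x + (exp (\<i> * of_real t) - 1) * e \<xi> x
          + (exp (- (\<i> * of_real t)) - 1) * (exp (\<i> * of_real t) * e \<xi> x)"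
      by (simp add: idempotent_exp_def)
    also have "\<dots> = \<xi> x + (exp (- (\<i> * of_real t)) * exp (\<i> * of_real t) - 1) * e \<xi> x"
      by (simp add: algebra_simps)
    finally show ?case by (simp flip: exp_add)
  qed
  have "Lp_norm p M \<xi> = Lp_norm p M (?U (- t) (?U t \<xi>))"
    by (rule Lp_norm_cong[OF p \<xi> Lp_operator_in[OF U Lp_operator_in[OF U \<xi>]]])
       (use inv in eventually_elim, simp)
  also have "\<dots> \<le> Lp_norm p M (?U t \<xi>)"
    by (rule contr[OF Lp_operator_in[OF U \<xi>]])
  finally show ?thesis using contr[OF \<xi>, of t] by simp
qed

text \<open>Let \<open>g\<close> live exactly on the zero set of \<open>\<xi>\<close>. The supports of \<open>\<xi> + z e \<xi>\<close> and \<open>g + z e g\<close> are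
  disjoint for \<open>z = exp (\<i> t) - 1\<close>. At a zero of \<open>\<xi>\<close> where \<open>e \<xi>\<close> does not vanish this gives
  \<open>g + z e g = 0\<close>, which two different values of \<open>z\<close> turn into the contradiction \<open>g = 0\<close>.\<close>

lemma hermitian_idempotent_local:
  assumes p: "1 \<le> p" "p \<noteq> 2" and \<sigma>: "sigma_finite_measure M" and e: "Lp_operator p M e"
    and idem: "Lp_idempotent p M e"
    and herm: "\<And>t::real. Lp_opnorm p M (idempotent_exp (\<i> * of_real t) e) = 1"
  shows "Lp_local p M e"
  unfolding Lp_local_def
proof
  have p0: "0 < p" using p by simp
  fix \<xi> assume \<xi>: "\<xi> \<in> Lp p M"
  obtain w where w: "w \<in> Lp p M" and w_nz: "\<And>x. x \<in> space M \<Longrightarrow> w x \<noteq> 0"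
    using Lp_nowhere_zero_exists[OF p0 \<sigma>] by blast
  define g where "g = mult_op {x \<in> space M. \<xi> x = 0} w"
  have "{x \<in> space M. \<xi> x = 0} \<in> sets M" using Lp_borel[OF \<xi>] by measurable
  hence g: "g \<in> Lp p M" unfolding g_def using p0 w by (intro mult_op_Lp) auto
  have disj: "AE x in M. \<xi> x = 0 \<or> g x = 0"
    by (rule AE_I2) (auto simp: g_def mult_op_def)
  have "AE x in M. \<xi> x + (cis t - 1) * e \<xi> x = 0 \<or> g x + (cis t - 1) * e g x = 0" for t
    using isometry_preserves_disjointness[OF p Lp_operator_idempotent_exp[OF p0 e]
        hermitian_exp_isometry[OF p0 e idem herm] \<xi> g disj, of t]
    by (simp add: idempotent_exp_def cis_conv_exp)
  \<comment> \<open>These two angles give \<open>z = - 2\<close> and \<open>z = \<i> - 1\<close>.\<close>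
  from this[of pi] this[of "pi / 2"] AE_space
  show "AE x in M. \<xi> x = 0 \<longrightarrow> e \<xi> x = 0"
  proof eventually_elim
    case (elim x)
    show ?case
    proof (intro impI, rule ccontr)
      assume zero: "\<xi> x = 0" and nz: "e \<xi> x \<noteq> 0"
      have "\<i> \<noteq> 1" by (simp add: complex_eq_iff)
      hence "g x - 2 * e g x = 0" "g x + (\<i> - 1) * e g x = 0" using elim zero nz by auto
      hence "(1 + \<i>) * e g x = 0" "g x = 2 * e g x" by (simp_all add: algebra_simps)
      moreover have "1 + \<i> \<noteq> 0" by (simp add: complex_eq_iff)
      ultimately have "g x = 0" by simp
      moreover have "g x = w x" using zero elim(3) by (simp add: g_def mult_op_def)
      ultimately show False using w_nz elim(3) by simp
    qed
  qed
qed

lemma hermitian_idempotent_is_mult_op: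
  assumes p: "1 \<le> p" "p \<noteq> 2" and \<sigma>: "sigma_finite_measure M"
    and herm: "hermitian_idempotent p M e"
  shows "\<exists>E\<in>sets M. Lp_op_eq p M e (mult_op E)"
proof -
  have p0: "0 < p" using p by simp
  have e: "Lp_operator p M e" and idem: "Lp_idempotent p M e"
    using herm by (auto simp: hermitian_idempotent_def)
  show ?thesis
  proof (cases "Lp_op_eq p M (\<lambda>\<xi>. \<xi>) (\<lambda>\<xi> x. 0)")
    case True
    have "Lp_op_eq p M e (mult_op {})"
      using True Lp_operator_in[OF e] by (auto simp: Lp_op_eq_def mult_op_def)
    thus ?thesis by blast
  next
    case False
    have "Lp_opnorm p M (idempotent_exp (\<i> * of_real t) e) = 1" for t :: real
      using herm False
      unfolding hermitian_idempotent_def Lp_opnorm_exp_idempotent[OF p0 e idem] by blast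
    from hermitian_idempotent_local[OF p \<sigma> e idem this] show ?thesis
      by (rule Lp_local_idempotent_is_mult_op[OF p0 \<sigma> e idem])
  qed
qed

text \<open>The exponential of \<open>\<i> t\<close> times a multiplication by an indicator function multiplies by a
  unimodular function and hence preserves the norm of every vector.\<close>

lemma mult_op_hermitian_idempotent:
  assumes p: "0 < p" and e: "Lp_operator p M e" and idem: "Lp_idempotent p M e"
    and eq: "Lp_op_eq p M e (mult_op E)"
  shows "hermitian_idempotent p M e"
proof -
  have "Lp_opnorm p M (idempotent_exp (\<i> * of_real t) e) = 1"
    if nontrivial: "\<not> Lp_op_eq p M (\<lambda>\<xi>. \<xi>) (\<lambda>\<xi> x. 0)" for t :: real
  proof -
    let ?U = "idempotent_exp (\<i> * of_real t) e"
    note U = Lp_operator_idempotent_exp[OF p e]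
    have norm_U: "Lp_norm p M (?U \<xi>) = Lp_norm p M \<xi>" if \<xi>: "\<xi> \<in> Lp p M" for \<xi>
    proof (rule Lp_norm_cong[OF p Lp_operator_in[OF U \<xi>] \<xi>])
      have "AE x in M. e \<xi> x = mult_op E \<xi> x" using eq \<xi> by (simp add: Lp_op_eq_def)
      thus "AE x in M. cmod (?U \<xi> x) = cmod (\<xi> x)"
      proof eventually_elim
        case (elim x)
        have "?U \<xi> x = (if x \<in> E then exp (\<i> * of_real t) * \<xi> x else \<xi> x)"
          using elim by (simp add: idempotent_exp_def mult_op_def algebra_simps)
        thus ?case by (simp add: norm_mult)
      qed
    qed
    obtain \<xi> where \<xi>: "\<xi> \<in> Lp p M" and "\<not> (AE x in M. \<xi> x = 0)"
      using nontrivial by (auto simp: Lp_op_eq_def)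
    hence "Lp_norm p M \<xi> > 0"
      using Lp_norm_eq_0_iff[OF p \<xi>] Lp_norm_nonneg[of p M \<xi>] by simp
    with Lp_norm_operator_le[OF p U \<xi>, of "\<i> * of_real t"] norm_U[OF \<xi>]
    have "1 \<le> Lp_opnorm p M ?U" by simp
    moreover have "Lp_opnorm p M ?U \<le> 1" by (rule Lp_opnorm_le) (simp add: norm_U)
    ultimately show ?thesis by simp
  qed
  thus ?thesis
    unfolding hermitian_idempotent_def Lp_opnorm_exp_idempotent[OF p e idem] using e idem by blast
qed

section \<open>Isomorphisms of measure algebras\<close>

lemma null_eq_iff_AE:
  assumes "A \<in> sets M" "B \<in> sets M"
  shows "null_eq M A B \<longleftrightarrow> (AE x in M. x \<in> A \<longleftrightarrow> x \<in> B)"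
proof -
  have "{x \<in> space M. \<not> (x \<in> A \<longleftrightarrow> x \<in> B)} = (A - B) \<union> (B - A)"
    using assms[THEN sets.sets_into_space] by auto
  moreover have "(A - B) \<union> (B - A) \<in> sets M" using assms by auto
  ultimately show ?thesis unfolding null_eq_def by (subst AE_iff_null) auto
qed

text \<open>Inside the locale, equality of classes is written as an equivalence that holds almost
  everywhere, so that facts about \<open>S\<close> combine pointwise.\<close>

locale measure_algebra_isomorphism =
  fixes M :: "'a measure" and E F :: "'a set" and S :: "'a set \<Rightarrow> 'a set"
  assumes E [measurable]: "E \<in> sets M" and F [measurable]: "F \<in> sets M"
    and iso: "measure_algebra_iso M E F S"
begin

lemma S_in: "A \<in> subsets_in M E \<Longrightarrow> S A \<in> subsets_in M F"
  using iso by (simp add: measure_algebra_iso_def)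

lemma S_sets [measurable]: "A \<in> subsets_in M E \<Longrightarrow> S A \<in> sets M"
  using S_in by (auto simp: subsets_in_def)

lemma S_subset: "A \<in> subsets_in M E \<Longrightarrow> S A \<subseteq> F"
  using S_in by (auto simp: subsets_in_def)

lemma S_cong:
  assumes "A \<in> subsets_in M E" "B \<in> subsets_in M E" "AE x in M. x \<in> A \<longleftrightarrow> x \<in> B"
  shows "AE x in M. x \<in> S A \<longleftrightarrow> x \<in> S B"
proof -
  have "null_eq M A B" using assms by (subst null_eq_iff_AE) (auto simp: subsets_in_def)
  hence "null_eq M (S A) (S B)" using iso assms by (simp add: measure_algebra_iso_def)
  thus ?thesis using assms S_sets by (simp add: null_eq_iff_AE)
qed

lemma S_surj:
  assumes "B \<in> subsets_in M F"
  obtains A where "A \<in> subsets_in M E" "AE x in M. x \<in> S A \<longleftrightarrow> x \<in> B"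
proof -
  obtain A where A: "A \<in> subsets_in M E" "null_eq M (S A) B"
    using iso assms unfolding measure_algebra_iso_def by blast
  moreover have "B \<in> sets M" using assms by (simp add: subsets_in_def)
  ultimately show thesis using S_sets that by (simp add: null_eq_iff_AE)
qed

lemma S_compl:
  assumes "A \<in> subsets_in M E"
  shows "AE x in M. x \<in> S (E - A) \<longleftrightarrow> x \<in> F \<and> x \<notin> S A"
proof -
  have "null_eq M (S (E - A)) (F - S A)"
    using iso assms by (simp add: measure_algebra_iso_def)
  moreover have "E - A \<in> subsets_in M E" using assms E by (auto simp: subsets_in_def)
  moreover have "F - S A \<in> sets M" using S_sets[OF assms] by auto
  ultimately show ?thesis using S_sets by (simp add: null_eq_iff_AE)
qed

lemma S_UN:
  assumes "\<And>n::nat. A n \<in> subsets_in M E"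
  shows "AE x in M. x \<in> S (\<Union>n. A n) \<longleftrightarrow> (\<exists>n. x \<in> S (A n))"
proof -
  have "null_eq M (S (\<Union>n. A n)) (\<Union>n. S (A n))"
    using iso assms unfolding measure_algebra_iso_def by blast
  moreover have "(\<Union>n. A n) \<in> subsets_in M E" using assms by (fastforce simp: subsets_in_def)
  moreover have "(\<Union>n. S (A n)) \<in> sets M" using S_sets assms by auto
  ultimately show ?thesis using S_sets by (simp add: null_eq_iff_AE)
qed

lemma S_Un:
  assumes "A \<in> subsets_in M E" "B \<in> subsets_in M E"
  shows "AE x in M. x \<in> S (A \<union> B) \<longleftrightarrow> x \<in> S A \<or> x \<in> S B"
proof -
  define C where "C n = (if n = 0 then A else B)" for n :: nat
  have "C n \<in> subsets_in M E" for n using assms by (simp add: C_def)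
  hence "AE x in M. x \<in> S (\<Union>n. C n) \<longleftrightarrow> (\<exists>n. x \<in> S (C n))" by (rule S_UN)
  moreover have "(\<Union>n. C n) = A \<union> B" by (auto simp: C_def split: if_splits)
  moreover have "(\<exists>n. x \<in> S (C n)) \<longleftrightarrow> x \<in> S A \<or> x \<in> S B" for x
    by (auto simp: C_def split: if_splits)
  ultimately show ?thesis by simp
qed

lemma empty_in: "{} \<in> subsets_in M E"
  by (simp add: subsets_in_def)

lemma full_in: "E \<in> subsets_in M E"
  by (simp add: subsets_in_def)

text \<open>The complement clause says that \<open>S {}\<close> and \<open>S E\<close> are complementary in \<open>F\<close>, and
  \<open>E = E \<union> {}\<close> says that \<open>S {}\<close> is contained in \<open>S E\<close>.\<close>

lemma S_empty: "AE x in M. x \<notin> S {}"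
  using S_Un[OF full_in empty_in] S_compl[OF empty_in] by eventually_elim auto

lemma S_full: "AE x in M. x \<in> S E \<longleftrightarrow> x \<in> F"
  using S_compl[OF empty_in] S_empty by eventually_elim simp

lemma S_disjoint:
  assumes "A \<in> subsets_in M E" "B \<in> subsets_in M E" "A \<inter> B = {}"
  shows "AE x in M. \<not> (x \<in> S A \<and> x \<in> S B)"
proof -
  have compl: "E - A \<in> subsets_in M E" using assms E by (auto simp: subsets_in_def)
  have "B \<union> (E - A) = E - A" using assms by (auto simp: subsets_in_def)
  with S_Un[OF assms(2) compl] S_compl[OF assms(1)]
  show ?thesis by (auto elim: eventually_elim2)
qed

text \<open>For a real function \<open>u\<close>, the function \<open>S\<^sub>* u\<close> is recovered from the images of the
  sublevel sets of \<open>u\<close> at rational levels, as their infimum. Its values \<open>\<plusminus>\<infinity>\<close> are confined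
  to a null set because \<open>S\<close> preserves \<open>\<emptyset>\<close> and the top element.\<close>

lemma push_real_exists:
  fixes u :: "'a \<Rightarrow> real"
  assumes u [measurable]: "u \<in> borel_measurable M"
  shows "\<exists>v\<in>borel_measurable (restrict_space M F).
    \<forall>r. AE y in M. y \<in> F \<longrightarrow> (v y < r \<longleftrightarrow> y \<in> S {x \<in> E. u x < r})"
proof -
  define L where "L r = {x \<in> E. u x < r}" for r
  have L: "L r \<in> subsets_in M E" for r
  proof -
    have "L r = {x \<in> space M. x \<in> E \<and> u x < r}"
      using sets.sets_into_space[OF E] by (auto simp: L_def)
    also have "\<dots> \<in> sets M" by measurable
    finally show ?thesis by (auto simp: subsets_in_def L_def)
  qed
  \<comment> \<open>The extended reals give the infimum of the empty set the value \<open>\<infinity>\<close>.\<close>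
  define v' :: "'a \<Rightarrow> ereal" where
    "v' y = (INF q::rat. if y \<in> S (L (of_rat q)) then ereal (of_rat q) else \<infinity>)" for y
  have v'_M [measurable]: "v' \<in> borel_measurable M"
    unfolding v'_def using S_sets[OF L] by measurable
  have v'_less: "v' y < ereal r \<longleftrightarrow> (\<exists>q. of_rat q < r \<and> y \<in> S (L (of_rat q)))" for y r
    unfolding v'_def INF_less_iff by (auto split: if_splits)
  have level: "AE y in M. v' y < ereal r \<longleftrightarrow> y \<in> S (L r)" for r
  proof -
    \<comment> \<open>Rational levels are enumerated by natural numbers; those not below \<open>r\<close> contribute \<open>{}\<close>.\<close>
    define A where "A n = (let q = from_nat n :: rat in if of_rat q < r then L (of_rat q) else {})" for n
    have A: "A n \<in> subsets_in M E" for n using L empty_in by (simp add: A_def Let_def)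
    have UN: "(\<Union>n. A n) = L r"
    proof (intro equalityI subsetI)
      fix x assume x: "x \<in> L r"
      then obtain q where q: "u x < of_rat q" "of_rat q < r"
        using of_rat_dense[of "u x" r] by (auto simp: L_def)
      hence "x \<in> A (to_nat q)" using x by (simp add: A_def L_def)
      thus "x \<in> (\<Union>n. A n)" by blast
    qed (auto simp: A_def L_def Let_def split: if_splits)
    have "AE y in M. y \<in> S (L r) \<longleftrightarrow> (\<exists>n. y \<in> S (A n))"
      using S_UN[of A, OF A] unfolding UN .
    with S_empty show ?thesis
    proof eventually_elim
      case (elim y)
      have "(\<exists>n. y \<in> S (A n)) \<longleftrightarrow> (\<exists>q::rat. of_rat q < r \<and> y \<in> S (L (of_rat q)))"
      proof
        assume "\<exists>n. y \<in> S (A n)"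
        then obtain n where "y \<in> S (A n)" by blast
        thus "\<exists>q::rat. of_rat q < r \<and> y \<in> S (L (of_rat q))"
          using elim by (auto simp: A_def Let_def split: if_splits)
      next
        assume "\<exists>q::rat. of_rat q < r \<and> y \<in> S (L (of_rat q))"
        then obtain q :: rat where "of_rat q < r" "y \<in> S (L (of_rat q))" by blast
        hence "y \<in> S (A (to_nat q))" by (simp add: A_def)
        thus "\<exists>n. y \<in> S (A n)" by blast
      qed
      thus ?case using elim v'_less by simp
    qed
  qed
  have below: "AE y in M. y \<in> F \<longrightarrow> v' y \<noteq> \<infinity>"
  proof -
    have "(\<Union>n. L (real n)) = E"
      using reals_Archimedean2 by (auto simp: L_def)
    with S_UN[of "\<lambda>n. L (real n)"] L S_full
    have "AE y in M. y \<in> F \<longrightarrow> (\<exists>n. y \<in> S (L (real n)))" by (auto elim: eventually_elim2)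
    moreover have "AE y in M. \<forall>n. v' y < ereal (real n) \<longleftrightarrow> y \<in> S (L (real n))"
      by (simp add: AE_all_countable level)
    ultimately show ?thesis by eventually_elim auto
  qed
  have above: "AE y in M. y \<in> F \<longrightarrow> v' y \<noteq> - \<infinity>"
  proof -
    have compl: "E - L (- real n) \<in> subsets_in M E" for n
      using E L by (auto simp: subsets_in_def)
    have UN: "(\<Union>n. E - L (- real n)) = E"
    proof -
      have "\<exists>n. \<not> u x < - real n" for x
      proof -
        obtain n where "- u x < real n" using reals_Archimedean2 by blast
        hence "\<not> u x < - real n" by simp
        thus ?thesis ..
      qed
      thus ?thesis by (auto simp: L_def)
    qed
    have "AE y in M. y \<in> S E \<longleftrightarrow> (\<exists>n. y \<in> S (E - L (- real n)))"
      using S_UN[of "\<lambda>n. E - L (- real n)", OF compl] unfolding UN .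
    with S_full have "AE y in M. y \<in> F \<longrightarrow> (\<exists>n. y \<in> S (E - L (- real n)))"
      by eventually_elim simp
    moreover have "AE y in M. \<forall>n. v' y < ereal (- real n) \<longleftrightarrow> y \<in> S (L (- real n))"
      unfolding AE_all_countable by (intro allI level)
    moreover have "AE y in M. \<forall>n. y \<in> S (E - L (- real n)) \<longleftrightarrow> y \<in> F \<and> y \<notin> S (L (- real n))"
      unfolding AE_all_countable by (intro allI S_compl L)
    ultimately show ?thesis by eventually_elim auto
  qed
  show ?thesis
  proof (intro bexI[of _ "\<lambda>y. real_of_ereal (v' y)"] allI)
    fix r
    from level[of r] below above
    show "AE y in M. y \<in> F \<longrightarrow> (real_of_ereal (v' y) < r \<longleftrightarrow> y \<in> S {x \<in> E. u x < r})"
    proof eventually_elim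
      case (elim y)
      thus ?case by (cases "v' y") (auto simp: L_def)
    qed
  qed (intro measurable_restrict_space1, measurable)
qed

text \<open>The real and imaginary parts give the defining property of \<open>S\<^sub>*(\<xi>)\<close> for half-planes. The sets
  with this property form a \<open>\<sigma>\<close>-algebra because \<open>S\<close> preserves complements and countable unions.\<close>

lemma push_exists:
  fixes \<xi> :: "'a \<Rightarrow> complex"
  assumes \<xi> [measurable]: "\<xi> \<in> borel_measurable M"
  shows "\<exists>\<eta>. \<eta> \<in> borel_measurable (restrict_space M F) \<and>
     (\<forall>U\<in>sets borel. null_eq M {y \<in> F. \<eta> y \<in> U} (S {x \<in> E. \<xi> x \<in> U}))"
proof -
  have Re_Im: "(\<lambda>x. Re (\<xi> x)) \<in> borel_measurable M" "(\<lambda>x. Im (\<xi> x)) \<in> borel_measurable M"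
    by measurable
  obtain v where v: "v \<in> borel_measurable (restrict_space M F)"
    "\<And>r. AE y in M. y \<in> F \<longrightarrow> (v y < r \<longleftrightarrow> y \<in> S {x \<in> E. Re (\<xi> x) < r})"
    using push_real_exists[OF Re_Im(1)] by blast
  obtain w where w: "w \<in> borel_measurable (restrict_space M F)"
    "\<And>r. AE y in M. y \<in> F \<longrightarrow> (w y < r \<longleftrightarrow> y \<in> S {x \<in> E. Im (\<xi> x) < r})"
    using push_real_exists[OF Re_Im(2)] by blast
  define \<eta> where "\<eta> y = complex_of_real (v y) + \<i> * complex_of_real (w y)" for y
  have \<eta>: "\<eta> \<in> borel_measurable (restrict_space M F)"
    unfolding \<eta>_def using v(1) w(1) by measurable
  have pre: "{x \<in> E. \<xi> x \<in> U} \<in> subsets_in M E" if "U \<in> sets borel" for U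
  proof -
    have "{x \<in> E. \<xi> x \<in> U} = E \<inter> (\<xi> -` U \<inter> space M)" using sets.sets_into_space[OF E] by auto
    also have "\<dots> \<in> sets M" using that by measurable
    finally show ?thesis by (auto simp: subsets_in_def)
  qed
  have *: "AE y in M. y \<in> F \<longrightarrow> (\<eta> y \<in> U \<longleftrightarrow> y \<in> S {x \<in> E. \<xi> x \<in> U})" if "U \<in> sets borel" for U
  proof -
    let ?G = "(\<lambda>(a, i). {x::complex. x \<bullet> i < a}) ` (UNIV \<times> Basis)"
    have borel: "sets borel = sigma_sets UNIV ?G"
      by (subst borel_eq_halfspace_less) (rule sets_measure_of, simp)
    from that have "U \<in> sigma_sets UNIV ?G" unfolding borel .
    thus ?thesis
    proof induction
      case (Basic U)
      then obtain a i where U: "U = {x. x \<bullet> i < a}" "i \<in> Basis" by auto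
      hence "i = 1 \<or> i = \<i>" by (simp add: Basis_complex_def)
      thus ?case
      proof
        assume "i = 1"
        with v(2)[of a] show ?thesis by (simp add: U \<eta>_def)
      next
        assume "i = \<i>"
        with w(2)[of a] show ?thesis by (simp add: U \<eta>_def)
      qed
    next
      case Empty
      show ?case using S_empty by eventually_elim simp
    next
      case (Compl U)
      have "{x \<in> E. \<xi> x \<in> UNIV - U} = E - {x \<in> E. \<xi> x \<in> U}" by auto
      moreover have "U \<in> sets borel" using Compl.hyps unfolding borel .
      ultimately show ?case using Compl.IH S_compl[OF pre[of U]]
        by simp (auto elim: eventually_elim2)
    next
      case (Union U)
      have "{x \<in> E. \<xi> x \<in> (\<Union>n. U n)} = (\<Union>n. {x \<in> E. \<xi> x \<in> U n})" by auto
      moreover have "U n \<in> sets borel" for n using Union.hyps unfolding borel .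
      moreover have "AE y in M. \<forall>n. y \<in> F \<longrightarrow> (\<eta> y \<in> U n \<longleftrightarrow> y \<in> S {x \<in> E. \<xi> x \<in> U n})"
        unfolding AE_all_countable by (intro allI Union.IH)
      ultimately show ?case using S_UN[of "\<lambda>n. {x \<in> E. \<xi> x \<in> U n}"] pre
        by simp (auto elim: eventually_elim2)
    qed
  qed
  show ?thesis
  proof (intro exI[of _ \<eta>] conjI ballI \<eta>)
    fix U :: "complex set" assume U: "U \<in> sets borel"
    have "{y \<in> F. \<eta> y \<in> U} = \<eta> -` U \<inter> space (restrict_space M F)"
      using sets.sets_into_space[OF F] by (auto simp: space_restrict_space)
    also have "\<dots> \<in> sets (restrict_space M F)" using \<eta> U by (rule measurable_sets)
    finally have "{y \<in> F. \<eta> y \<in> U} \<in> sets M" using F by (simp add: sets_restrict_space_iff)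
    moreover have "AE y in M. y \<in> {y \<in> F. \<eta> y \<in> U} \<longleftrightarrow> y \<in> S {x \<in> E. \<xi> x \<in> U}"
      using *[OF U] by eventually_elim (use S_subset[OF pre[OF U]] in auto)
    ultimately show "null_eq M {y \<in> F. \<eta> y \<in> U} (S {x \<in> E. \<xi> x \<in> U})"
      using S_sets[OF pre[OF U]] by (simp add: null_eq_iff_AE)
  qed
qed

lemma push_fun_support:
  fixes \<xi> :: "'a \<Rightarrow> complex"
  assumes \<xi> [measurable]: "\<xi> \<in> borel_measurable M"
  shows "AE y in M. y \<in> F \<longrightarrow> (push_fun M E F S \<xi> y \<noteq> 0 \<longleftrightarrow> y \<in> S {x \<in> E. \<xi> x \<noteq> 0})"
proof -
  let ?\<eta> = "push_fun M E F S \<xi>"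
  have push: "?\<eta> \<in> borel_measurable (restrict_space M F)"
    "\<And>U. U \<in> sets borel \<Longrightarrow> null_eq M {y \<in> F. ?\<eta> y \<in> U} (S {x \<in> E. \<xi> x \<in> U})"
    using someI_ex[OF push_exists[OF \<xi>]] unfolding push_fun_def by blast+
  have "{x \<in> E. \<xi> x \<noteq> 0} = {x \<in> space M. x \<in> E \<and> \<xi> x \<noteq> 0}"
    using sets.sets_into_space[OF E] by auto
  also have "\<dots> \<in> sets M" by measurable
  finally have supp: "{x \<in> E. \<xi> x \<noteq> 0} \<in> subsets_in M E" by (auto simp: subsets_in_def)
  have "{y \<in> F. ?\<eta> y \<noteq> 0} = ?\<eta> -` (- {0}) \<inter> space (restrict_space M F)"
    using sets.sets_into_space[OF F] by (auto simp: space_restrict_space)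
  also have "\<dots> \<in> sets (restrict_space M F)" using push(1) by (rule measurable_sets) auto
  finally have "{y \<in> F. ?\<eta> y \<noteq> 0} \<in> sets M" using F by (simp add: sets_restrict_space_iff)
  hence "AE y in M. y \<in> {y \<in> F. ?\<eta> y \<noteq> 0} \<longleftrightarrow> y \<in> S {x \<in> E. \<xi> x \<noteq> 0}"
    using push(2)[of "- {0}"] S_sets[OF supp] by (simp add: null_eq_iff_AE)
  thus ?thesis by eventually_elim auto
qed

end

section \<open>Spatial partial isometries\<close>

text \<open>Write \<open>m\<close> for the weight of the operator and \<open>H\<close> for its support. The support of \<open>e \<xi>\<close> is
  \<open>T (supp \<xi>)\<close> with \<open>T A = H \<inter> S (E \<inter> A)\<close>. Idempotence of \<open>e\<close> gives \<open>T (T A) = T A\<close>, and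
  \<open>T\<close> maps onto the measurable subsets of \<open>H\<close>; so \<open>T\<close> fixes them, and being disjointness preserving it
  kills the subsets of the complement of \<open>H\<close>. Hence \<open>T A = H \<inter> A\<close>, and \<open>e\<close> is local.\<close>

lemma spatial_idempotent_local:
  assumes p: "0 < p" and \<sigma>: "sigma_finite_measure M" and idem: "Lp_idempotent p M e"
    and spatial: "spatial_partial_isometry p M e"
  shows "Lp_local p M e"
proof -
  obtain E F S g where e: "Lp_operator p M e" and sys: "spatial_system M E F S g"
    and form: "\<And>\<xi>. \<xi> \<in> Lp p M \<Longrightarrow> AE y in M. e \<xi> y =
           (if y \<in> F
            then g y * of_real (enn2real (RN_deriv (restrict_space M F) (push_measure M E F S) y)
                                  powr (1 / p)) * push_fun M E F S \<xi> y
            else 0)"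
    using spatial unfolding spatial_partial_isometry_def by blast
  interpret measure_algebra_isomorphism M E F S
    using sys by unfold_locales (auto simp: spatial_system_def)
  define m where "m y = g y * complex_of_real
    (enn2real (RN_deriv (restrict_space M F) (push_measure M E F S) y) powr (1 / p))" for y
  have [measurable]: "g \<in> borel_measurable (restrict_space M F)"
    using sys by (simp add: spatial_system_def)
  have m: "m \<in> borel_measurable (restrict_space M F)"
    unfolding m_def by measurable
  define H where "H = {y \<in> F. m y \<noteq> 0}"
  have "H = m -` (- {0}) \<inter> space (restrict_space M F)"
    using sets.sets_into_space[OF F] by (auto simp: H_def space_restrict_space)
  also have "\<dots> \<in> sets (restrict_space M F)" using m by (rule measurable_sets) auto
  finally have H [measurable]: "H \<in> sets M" using F by (simp add: sets_restrict_space_iff)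
  define T where "T A = H \<inter> S (E \<inter> A)" for A
  have in_E: "E \<inter> A \<in> subsets_in M E" if "A \<in> sets M" for A
    using that E by (auto simp: subsets_in_def)
  have T_sets: "T A \<in> sets M" if "A \<in> sets M" for A
    unfolding T_def using H S_sets[OF in_E[OF that]] by (rule sets.Int)
  have T_cong: "AE y in M. y \<in> T A \<longleftrightarrow> y \<in> T B"
    if "A \<in> sets M" "B \<in> sets M" "AE x in M. x \<in> A \<longleftrightarrow> x \<in> B" for A B
  proof -
    have "AE x in M. x \<in> E \<inter> A \<longleftrightarrow> x \<in> E \<inter> B" using that(3) by eventually_elim auto
    from S_cong[OF in_E[OF that(1)] in_E[OF that(2)] this]
    show ?thesis by eventually_elim (auto simp: T_def)
  qed
  have supp_sets: "{x \<in> space M. \<xi> x \<noteq> 0} \<in> sets M" if "\<xi> \<in> Lp p M" for \<xi>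
    using Lp_borel[OF that] by measurable
  have supp: "AE y in M. e \<xi> y \<noteq> 0 \<longleftrightarrow> y \<in> T {x \<in> space M. \<xi> x \<noteq> 0}" if \<xi>: "\<xi> \<in> Lp p M" for \<xi>
  proof -
    have eq: "E \<inter> {x \<in> space M. \<xi> x \<noteq> 0} = {x \<in> E. \<xi> x \<noteq> 0}"
      using sets.sets_into_space[OF E] by auto
    from form[OF \<xi>] push_fun_support[OF Lp_borel[OF \<xi>]] show ?thesis
      unfolding m_def[symmetric] by eventually_elim (auto simp: T_def H_def eq)
  qed
  obtain w where w: "w \<in> Lp p M" and w_nz: "\<And>x. x \<in> space M \<Longrightarrow> w x \<noteq> 0"
    using Lp_nowhere_zero_exists[OF p \<sigma>] by blast
  have T_idem: "AE y in M. y \<in> T (T A) \<longleftrightarrow> y \<in> T A" if A: "A \<in> sets M" for A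
  proof -
    let ?f = "mult_op A w"
    have f: "?f \<in> Lp p M" using p w A by (intro mult_op_Lp) auto
    have "{x \<in> space M. ?f x \<noteq> 0} = A"
      using w_nz sets.sets_into_space[OF A] by (auto simp: mult_op_def indicator_def)
    hence f_supp: "AE y in M. e ?f y \<noteq> 0 \<longleftrightarrow> y \<in> T A" using supp[OF f] by simp
    have ef: "e ?f \<in> Lp p M" by (rule Lp_operator_in[OF e f])
    have "AE x in M. x \<in> {x \<in> space M. e ?f x \<noteq> 0} \<longleftrightarrow> x \<in> T A"
      using f_supp AE_space by eventually_elim simp
    from T_cong[OF supp_sets[OF ef] T_sets[OF A] this] supp[OF ef] idempotentD[OF idem f] f_supp
    show ?thesis by eventually_elim simp
  qed
  have T_fix: "AE y in M. y \<in> T B \<longleftrightarrow> y \<in> B" if B: "B \<in> sets M" "B \<subseteq> H" for B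
  proof -
    have "B \<in> subsets_in M F" using B by (auto simp: subsets_in_def H_def)
    then obtain A where A: "A \<in> subsets_in M E" "AE x in M. x \<in> S A \<longleftrightarrow> x \<in> B"
      by (rule S_surj)
    have A': "A \<in> sets M" "E \<inter> A = A" using A(1) by (auto simp: subsets_in_def)
    have TA: "AE x in M. x \<in> T A \<longleftrightarrow> x \<in> B"
      using A(2) by eventually_elim (use A'(2) B(2) in \<open>auto simp: T_def\<close>)
    from T_cong[OF T_sets[OF A'(1)] B(1) TA] T_idem[OF A'(1)] TA
    show ?thesis by eventually_elim simp
  qed
  have T_shrinks: "AE y in M. y \<in> T A \<longrightarrow> y \<in> A" if A: "A \<in> sets M" for A
  proof -
    have AH: "A \<inter> H \<in> sets M" "A - H \<in> sets M" using A H by auto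
    have "(E \<inter> (A - H)) \<inter> (E \<inter> H) = {}" by auto
    from S_disjoint[OF in_E[OF AH(2)] in_E[OF H] this] T_fix[OF H subset_refl]
      T_fix[OF AH(1)] S_Un[OF in_E[OF AH(1)] in_E[OF AH(2)]]
    have "AE y in M. y \<in> H \<inter> S (E \<inter> (A \<inter> H) \<union> E \<inter> (A - H)) \<longrightarrow> y \<in> A"
      by simp (auto simp: T_def elim: eventually_elim2)
    moreover have "E \<inter> (A \<inter> H) \<union> E \<inter> (A - H) = E \<inter> A" by auto
    ultimately show ?thesis by (simp add: T_def)
  qed
  show ?thesis
    unfolding Lp_local_def
  proof
    fix \<xi> assume \<xi>: "\<xi> \<in> Lp p M"
    from supp[OF \<xi>] T_shrinks[OF supp_sets[OF \<xi>]]
    show "AE x in M. \<xi> x = 0 \<longrightarrow> e \<xi> x = 0" by eventually_elim auto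
  qed
qed

lemma measure_algebra_iso_id:
  assumes "E \<in> sets M"
  shows "measure_algebra_iso M E E (\<lambda>A. A)"
  unfolding measure_algebra_iso_def
proof (intro conjI ballI allI impI)
  fix B assume "B \<in> subsets_in M E"
  thus "\<exists>A\<in>subsets_in M E. null_eq M A B" by (intro bexI[of _ B]) (auto simp: null_eq_def)
qed (auto simp: null_eq_def)

text \<open>Two functions for which preimages of the members of a countable basis agree up to null sets agree
  almost everywhere.\<close>

lemma push_fun_id:
  fixes \<xi> :: "'a \<Rightarrow> complex"
  assumes E: "E \<in> sets M" and \<xi> [measurable]: "\<xi> \<in> borel_measurable M"
  shows "AE y in M. y \<in> E \<longrightarrow> push_fun M E E (\<lambda>A. A) \<xi> y = \<xi> y"
proof -
  let ?\<eta> = "push_fun M E E (\<lambda>A. A) \<xi>"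
  have "\<xi> \<in> borel_measurable (restrict_space M E) \<and>
     (\<forall>U\<in>sets borel. null_eq M {y \<in> E. \<xi> y \<in> U} {x \<in> E. \<xi> x \<in> U})"
    by (auto simp: null_eq_def intro!: measurable_restrict_space1)
  from someI[where P = "\<lambda>\<eta>. \<eta> \<in> borel_measurable (restrict_space M E) \<and>
     (\<forall>U\<in>sets borel. null_eq M {y \<in> E. \<eta> y \<in> U} {x \<in> E. \<xi> x \<in> U})", OF this]
  have "\<And>U. U \<in> sets borel \<Longrightarrow> null_eq M {y \<in> E. ?\<eta> y \<in> U} {x \<in> E. \<xi> x \<in> U}"
    unfolding push_fun_def by blast
  hence *: "AE y in M. y \<notin> ({y \<in> E. ?\<eta> y \<in> U} - {x \<in> E. \<xi> x \<in> U})" if "U \<in> sets borel" for U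
    using AE_not_in[of "({y \<in> E. ?\<eta> y \<in> U} - {x \<in> E. \<xi> x \<in> U}) \<union>
        ({x \<in> E. \<xi> x \<in> U} - {y \<in> E. ?\<eta> y \<in> U})" M] that
    unfolding null_eq_def by (auto elim: eventually_mono)
  obtain B :: "complex set set" where B: "countable B" "topological_basis B"
    using ex_countable_basis by blast
  have "AE y in M. \<forall>U\<in>B. y \<notin> ({y \<in> E. ?\<eta> y \<in> U} - {x \<in> E. \<xi> x \<in> U})"
    using B by (intro AE_ball_countable' *) (auto dest: topological_basis_open)
  thus ?thesis
  proof eventually_elim
    case (elim y)
    show ?case
    proof (intro impI, rule ccontr)
      assume y: "y \<in> E" and "?\<eta> y \<noteq> \<xi> y"
      then obtain V where V: "open V" "?\<eta> y \<in> V" "\<xi> y \<notin> V" by (auto dest: t1_space)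
      then obtain U where "U \<in> B" "?\<eta> y \<in> U" "U \<subseteq> V"
        using topological_basisE[OF B(2)] by metis
      thus False using elim y V by blast
    qed
  qed
qed

lemma push_measure_id:
  assumes E: "E \<in> sets M"
  shows "push_measure M E E (\<lambda>A. A) = restrict_space M E"
proof -
  have sets: "subsets_in M E = (\<inter>) E ` sets M"
    using E by (auto simp: subsets_in_def image_iff intro: sets.Int)
  have E_space: "E \<inter> space M = E" using sets.sets_into_space[OF E] by auto
  have "sigma_algebra E (subsets_in M E)"
    using sets.restricted_sigma_algebra[OF E] unfolding sets by simp
  hence sigma: "sigma_sets E (subsets_in M E) = subsets_in M E"
    by (rule sigma_algebra.sigma_sets_eq)
  have "push_measure M E E (\<lambda>A. A) = measure_of E (subsets_in M E) (emeasure M)"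
    unfolding push_measure_def
  proof (rule measure_of_eq)
    fix B assume "B \<in> sigma_sets E (subsets_in M E)"
    hence B: "B \<in> subsets_in M E" unfolding sigma .
    let ?A = "SOME A. A \<in> subsets_in M E \<and> null_eq M A B"
    have "B \<in> subsets_in M E \<and> null_eq M B B" using B by (simp add: null_eq_def)
    hence "?A \<in> subsets_in M E \<and> null_eq M ?A B" by (rule someI)
    thus "emeasure M ?A = emeasure M B"
      using B by (intro emeasure_eq_AE) (auto simp: subsets_in_def null_eq_iff_AE)
  qed (auto simp: subsets_in_def)
  thus ?thesis by (simp add: restrict_space_def E_space sets)
qed

text \<open>Multiplication by \<open>\<chi>\<^sub>E\<close> comes from the system \<open>(E, E, id, 1)\<close>, whose push-forward measure is
  \<open>\<mu>|\<^sub>E\<close> itself, with derivative 1.\<close>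

lemma mult_op_spatial_partial_isometry:
  assumes \<sigma>: "sigma_finite_measure M" and e: "Lp_operator p M e"
    and E: "E \<in> sets M" and eq: "Lp_op_eq p M e (mult_op E)"
  shows "spatial_partial_isometry p M e"
proof -
  let ?R = "restrict_space M E"
  interpret R: sigma_finite_measure ?R by (rule sigma_finite_measure_restrict_space[OF \<sigma> E])
  have "AE y in ?R. 1 = RN_deriv ?R (push_measure M E E (\<lambda>A. A)) y"
    unfolding push_measure_id[OF E] by (rule R.RN_deriv_unique) (simp_all add: density_1)
  hence deriv: "AE y in M. y \<in> E \<longrightarrow> 1 = RN_deriv ?R (push_measure M E E (\<lambda>A. A)) y"
    using E by (subst (asm) AE_restrict_space_iff) auto
  have "spatial_system M E E (\<lambda>A. A) (\<lambda>y. 1)"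
    using E measure_algebra_iso_id[OF E] by (simp add: spatial_system_def)
  moreover have "AE y in M. e \<xi> y =
      (if y \<in> E
       then (\<lambda>y. 1) y * of_real (enn2real (RN_deriv ?R (push_measure M E E (\<lambda>A. A)) y)
                           powr (1 / p)) * push_fun M E E (\<lambda>A. A) \<xi> y
       else 0)" if \<xi>: "\<xi> \<in> Lp p M" for \<xi>
  proof -
    have "AE x in M. e \<xi> x = mult_op E \<xi> x" using eq \<xi> by (simp add: Lp_op_eq_def)
    with deriv push_fun_id[OF E Lp_borel[OF \<xi>]] show ?thesis
    proof eventually_elim
      case (elim y)
      show ?case
      proof (cases "y \<in> E")
        case True
        with elim have "RN_deriv ?R (push_measure M E E (\<lambda>A. A)) y = 1"
          "push_fun M E E (\<lambda>A. A) \<xi> y = \<xi> y" "e \<xi> y = \<xi> y" by (auto simp: mult_op_def)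
        thus ?thesis using True by simp
      next
        case False
        thus ?thesis using elim by (simp add: mult_op_def)
      qed
    qed
  qed
  ultimately show ?thesis using e unfolding spatial_partial_isometry_def by blast
qed

section \<open>The equivalence\<close>

theorem lemma6p9:
  fixes p :: real and M :: "'a measure" and e :: "('a \<Rightarrow> complex) \<Rightarrow> ('a \<Rightarrow> complex)"
  assumes "1 \<le> p" and "p \<noteq> 2"
    and "sigma_finite_measure M"
    and "Lp_operator p M e"
    and "Lp_idempotent p M e"
  shows "(hermitian_idempotent p M e \<longleftrightarrow> spatial_partial_isometry p M e) \<and>
    (spatial_partial_isometry p M e \<longleftrightarrow> (\<exists>E\<in>sets M. Lp_op_eq p M e (mult_op E)))"
proof -
  have p0: "0 < p" using assms(1) by simp
  have "\<exists>E\<in>sets M. Lp_op_eq p M e (mult_op E)" if "spatial_partial_isometry p M e"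
    using spatial_idempotent_local[OF p0 assms(3,5) that]
    by (rule Lp_local_idempotent_is_mult_op[OF p0 assms(3-5)])
  thus ?thesis
    using hermitian_idempotent_is_mult_op[OF assms(1-3)] mult_op_hermitian_idempotent[OF p0 assms(4,5)]
      mult_op_spatial_partial_isometry[OF assms(3,4)] by blast
qed

end
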